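(* Let $\delta$ be an associative algebra structure on $W$ and $\mu$ an associative algebra structure on $M$. The equivalence classes of extensions of $\delta$ by $\mu$ under the action of the group $G^{\text{rest}}$ of restricted equivalences are completely classified by the cohomology classes $\bar\lambda\in H_\mu^{1,1}$ which satisfy the condition $$\overline{[\delta+\lambda,\delta+\lambda]}=0\in H_\mu^{1,2}(\ker(D_{\delta+\lambda}))$$ together with the cohomology classes $[\bar\tau]\in H^{0,2}_{\mu,\delta+\lambda}$. That is: (i) the class $\bar\lambda$ of an extension $\delta+\mu+\lambda+\psi$ depends only on its $G^{\text{rest}}$-equivalence class, and a class $\bar\lambda\in H_\mu^{1,1}$ arises in this way if and only if it satisfies the displayed condition (which is independent of the representative $\lambda$); (ii) for each such class, fixing a representative $\lambda$ and one $\psi$ such that $\delta+\mu+\lambda+\psi$ is an extension, the map $[\bar\tau]\mapsto\delta+\mu+\lambda+\psi+\tau$ induces a bijection from $H^{0,2}_{\mu,\delta+\lambda}$ to the set of $G^{\text{rest}}$-equivalence classes of extensions with class $\bar\lambda$.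
   Context: Work over a field $\mathbb K$ of characteristic different from 2 and 3. $M,W$ are $\mathbb Z_2$-graded vector spaces and $V=M\oplus W$ (parity-reversed convention: an ordinary ungraded algebra corresponds to a completely odd space). Let $C(V)=\operatorname{Hom}(T(V),V)$, $T(V)=\bigoplus_n V^{\otimes n}$. For $\varphi\in\operatorname{Hom}(V^{\otimes k},V)$ and $\chi\in\operatorname{Hom}(V^{\otimes l},V)$ put $$(\varphi\circ\chi)(v_1,\dots,v_{k+l-1})=\sum_i(-1)^{|\chi|(|v_1|+\dots+|v_{i-1}|)}\varphi(v_1,\dots,v_{i-1},\chi(v_i,\dots,v_{i+l-1}),\dots,v_{k+l-1}),$$ and $[\varphi,\chi]=\varphi\circ\chi-(-1)^{|\varphi||\chi|}\chi\circ\varphi$ (the graded Lie bracket of coderivations of $T(V)$). Maps defined on a summand of $T(V)$ are extended by zero. A codifferential is an odd $d$ with $[d,d]=0$; an odd $d\in\operatorname{Hom}(V^{\otimes2},V)$ is an associative algebra structure iff $[d,d]=0$. Let $T^{k,l}(M,W)\subseteq V^{\otimes(k+l)}$ be spanned by tensors of $k$ elements of $M$ and $l$ elements of $W$ in any order, $C^{k,l}=\operatorname{Hom}(T^{k,l}(M,W),M)$, and $C^k=\operatorname{Hom}(W^{\otimes k},W)$. Thus $\delta\in C^2$, $\mu\in C^{2,0}$ are odd with $[\delta,\delta]=[\mu,\mu]=0$. An extension of $\delta$ by $\mu$ is a codifferential $d=\delta+\mu+\lambda+\psi$ on $V$ with odd $\lambda\in C^{1,1}$, $\psi\in C^{0,2}$;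 equivalently $[\delta,\lambda]+\tfrac12[\lambda,\lambda]+[\mu,\psi]=0$, $[\mu,\lambda]=0$, $[\delta+\lambda,\psi]=0$. $G^{\text{rest}}$ is the group of maps $f=\exp(\beta)$, $f(m,w)=(m+\beta(w),w)$, with $\beta\in C^{0,1}=\operatorname{Hom}(W,M)$ even; it acts on extensions by $f^*(d)=f^{-1}\circ d\circ(f\otimes f)$. For $\alpha\in C(V)$ put $D_\alpha=[\alpha,\cdot\,]$. - $D_\mu:C^{k,l}\to C^{k+1,l}$ squares to zero; $H_\mu^{k,l}=\ker(D_\mu|_{C^{k,l}})/D_\mu(C^{k-1,l})$ (with $C^{-1,l}=0$), the class of $\varphi$ being $\bar\varphi$. - For $\lambda\in C^{1,1}$ odd with $[\mu,\lambda]=0$, $D_{\delta+\lambda}:C^{k,l}\to C^{k,l+1}$ anticommutes with $D_\mu$, and $H_\mu^{1,2}(\ker(D_{\delta+\lambda}))=\{\varphi\in C^{1,2}:D_\mu\varphi=0,\ D_{\delta+\lambda}\varphi=0\}/D_\mu\{\psi\in C^{0,2}:D_{\delta+\lambda}\psi=0\}$. The element $[\delta+\lambda,\delta+\lambda]=2[\delta,\lambda]+[\lambda,\lambda]$ lies in the numerator. - If the displayed condition holds, $D_{\bar\delta+\bar\lambda}:H_\mu^{k,l}\to H_\mu^{k,l+1}$, $\bar\varphi\mapsto\overline{[\delta+\lambda,\varphi]}$, squares to zero, and $H_{\mu,\delta+\lambda}^{0,2}=\ker(D_{\bar\delta+\bar\lambda}:H_\mu^{0,2}\to H_\mu^{0,3})/D_{\bar\delta+\bar\lambda}(H_\mu^{0,1})$;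 the class of $\bar\tau$ is $[\bar\tau]$. Convention: in $H_\mu^{1,1}$ and $H_{\mu,\delta+\lambda}^{0,2}$ only classes of odd cochains are considered (automatic when $V$ is completely odd). *)

theory Defs
  imports
    "HOL-Analysis.Product_Vector"
    "HOL-Library.Function_Algebras"
    "HOL-Library.Set_Algebras"
    "HOL-Library.Z2"
begin

section \<open>Graded vector spaces\<close>

text \<open>Parities are elements of the field \<^typ>\<open>bit\<close> with two elements; 1 is odd. An ordinary
  ungraded algebra corresponds to a space with \<open>homog V 1 = UNIV\<close>, \<open>homog V 0 = {0}\<close>.\<close>

record ('k, 'v) graded_space =
  smult :: "'k \<Rightarrow> 'v \<Rightarrow> 'v"
  homog :: "bit \<Rightarrow> 'v set"

definition graded_vector_space :: "('k::field, 'v::ab_group_add) graded_space \<Rightarrow> bool" where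
  "graded_vector_space V \<longleftrightarrow>
     vector_space (smult V) \<and>
     (\<forall>p. module.subspace (smult V) (homog V p)) \<and>
     (\<forall>v. \<exists>!x. x \<in> homog V 0 \<and> v - x \<in> homog V 1)"

definition direct_sum ::
  "('k::field, 'm::ab_group_add) graded_space \<Rightarrow> ('k, 'w::ab_group_add) graded_space
     \<Rightarrow> ('k, 'm \<times> 'w) graded_space" (infixr \<open>\<uplus>\<close> 65) where
  "M \<uplus> W = \<lparr> smult = module_prod.scale (smult M) (smult W),
              homog = (\<lambda>p. homog M p \<times> homog W p) \<rparr>"

definition hpart :: "('k, 'v::ab_group_add) graded_space \<Rightarrow> bit \<Rightarrow> 'v \<Rightarrow> 'v" where
  "hpart V p v = (THE x. x \<in> homog V p \<and> v - x \<in> homog V (p + 1))"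

text \<open>\<open>sg p x\<close> is $(-1)^p x$, and \<open>twist V p\<close> is the linear map which on homogeneous
  vectors is $v \mapsto (-1)^{p|v|} v$. Applying \<open>twist\<close> to the arguments of a map is how the
  Koszul signs are written for arguments that need not be homogeneous.\<close>

definition sg :: "bit \<Rightarrow> 'a::uminus \<Rightarrow> 'a" where
  "sg p x = (if p = 0 then x else - x)"

definition twist :: "('k, 'v::ab_group_add) graded_space \<Rightarrow> bit \<Rightarrow> 'v \<Rightarrow> 'v" where
  "twist V p v = hpart V 0 v + sg p (hpart V 1 v)"


section \<open>Cochains and their bracket\<close>

text \<open>An element of $C(V) = \mathrm{Hom}(T(V), V)$ is encoded as a function on lists of vectors
  whose restriction to the lists of each fixed length is multilinear. Sums and differences of
  cochains are the pointwise ones.\<close>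

definition cochains :: "('k::field, 'v::ab_group_add) graded_space \<Rightarrow> ('v list \<Rightarrow> 'v) set" where
  "cochains V = {\<phi>. \<forall>us vs. Vector_Spaces.linear (smult V) (smult V) (\<lambda>x. \<phi> (us @ x # vs))}"

definition has_parity ::
  "('k, 'v) graded_space \<Rightarrow> bit \<Rightarrow> ('v list \<Rightarrow> 'v) \<Rightarrow> bool" where
  "has_parity V p \<phi> \<longleftrightarrow>
     (\<forall>vs qs. list_all2 (\<lambda>v q. v \<in> homog V q) vs qs \<longrightarrow> \<phi> vs \<in> homog V (p + sum_list qs))"

text \<open>The component of parity \<open>p\<close> of a cochain: if $\sigma$ is the parity involution of \<open>V\<close>, then
  $\sigma \circ \varphi \circ \sigma^{\otimes n} = (-1)^q \varphi$ for \<open>\<phi>\<close> of parity \<open>q\<close>. This needs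
  characteristic different from 2.\<close>

definition parity_part ::
  "('k::field, 'v::ab_group_add) graded_space \<Rightarrow> bit \<Rightarrow> ('v list \<Rightarrow> 'v) \<Rightarrow> 'v list \<Rightarrow> 'v" where
  "parity_part V p \<phi> =
     (\<lambda>vs. smult V (1 / 2) (\<phi> vs + sg p (twist V 1 (\<phi> (map (twist V 1) vs)))))"

text \<open>\<open>circ V q \<phi> \<chi>\<close> is $\varphi \circ \chi$ for \<open>\<chi>\<close> of parity \<open>q\<close>. The sum over \<open>l\<close> is the sum over
  the homogeneous components of \<open>\<chi>\<close> in $\mathrm{Hom}(V^{\otimes l}, V)$.\<close>

definition circ ::
  "('k, 'v::ab_group_add) graded_space \<Rightarrow> bit \<Rightarrow>
     ('v list \<Rightarrow> 'v) \<Rightarrow> ('v list \<Rightarrow> 'v) \<Rightarrow> 'v list \<Rightarrow> 'v" where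
  "circ V q \<phi> \<chi> = (\<lambda>vs. \<Sum>l\<le>length vs. \<Sum>i\<le>length vs - l.
     \<phi> (map (twist V q) (take i vs) @ \<chi> (take l (drop i vs)) # drop (i + l) vs))"

text \<open>The graded commutator, extended bilinearly to cochains that are not homogeneous.\<close>

definition bracket ::
  "('k::field, 'v::ab_group_add) graded_space \<Rightarrow>
     ('v list \<Rightarrow> 'v) \<Rightarrow> ('v list \<Rightarrow> 'v) \<Rightarrow> 'v list \<Rightarrow> 'v" where
  "bracket V \<phi> \<chi> = (\<Sum>p\<in>{0, 1}. \<Sum>q\<in>{0, 1}.
     circ V q (parity_part V p \<phi>) (parity_part V q \<chi>)
     - sg (p * q) (circ V p (parity_part V q \<chi>) (parity_part V p \<phi>)))"

definition codifferential ::
  "('k::field, 'v::ab_group_add) graded_space \<Rightarrow> ('v list \<Rightarrow> 'v) \<Rightarrow> bool" where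
  "codifferential V d \<longleftrightarrow> d \<in> cochains V \<and> has_parity V 1 d \<and> bracket V d d = 0"


section \<open>Cochains on a direct sum\<close>

text \<open>The pure tensors with \<open>k\<close> factors in \<open>M\<close> and \<open>l\<close> factors in \<open>W\<close>, in any order; they span
  $T^{k,l}(M,W)$.\<close>

definition pure_tensors :: "nat \<Rightarrow> nat \<Rightarrow> ('m::zero \<times> 'w::zero) list set" where
  "pure_tensors k l =
     {map (case_sum (\<lambda>m. (m, 0)) (\<lambda>w. (0, w))) xs | xs.
        length (filter isl xs) = k \<and> length (filter (\<lambda>x. \<not> isl x) xs) = l}"

text \<open>Cochains on the summand $T^{k,l}(M,W)$ of $T(V)$, extended by zero to the other summands.\<close>

definition supported_cochains ::
  "('k::field, 'm::ab_group_add) graded_space \<Rightarrow> ('k, 'w::ab_group_add) graded_space \<Rightarrow>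
     nat \<Rightarrow> nat \<Rightarrow> (('m \<times> 'w) list \<Rightarrow> 'm \<times> 'w) set" where
  "supported_cochains M W k l =
     {\<phi> \<in> cochains (M \<uplus> W).
        \<forall>i j. (i, j) \<noteq> (k, l) \<longrightarrow> (\<forall>vs \<in> pure_tensors i j. \<phi> vs = 0)}"

definition CM ::
  "('k::field, 'm::ab_group_add) graded_space \<Rightarrow> ('k, 'w::ab_group_add) graded_space \<Rightarrow>
     nat \<Rightarrow> nat \<Rightarrow> (('m \<times> 'w) list \<Rightarrow> 'm \<times> 'w) set" where
  "CM M W k l = {\<phi> \<in> supported_cochains M W k l. \<forall>vs. snd (\<phi> vs) = 0}"

definition CW ::
  "('k::field, 'm::ab_group_add) graded_space \<Rightarrow> ('k, 'w::ab_group_add) graded_space \<Rightarrow>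
     nat \<Rightarrow> (('m \<times> 'w) list \<Rightarrow> 'm \<times> 'w) set" where
  "CW M W k = {\<phi> \<in> supported_cochains M W 0 k. \<forall>vs. fst (\<phi> vs) = 0}"

definition algebra_structure_M ::
  "('k::field, 'm::ab_group_add) graded_space \<Rightarrow> ('k, 'w::ab_group_add) graded_space \<Rightarrow>
     (('m \<times> 'w) list \<Rightarrow> 'm \<times> 'w) \<Rightarrow> bool" where
  "algebra_structure_M M W \<mu> \<longleftrightarrow> \<mu> \<in> CM M W 2 0 \<and> codifferential (M \<uplus> W) \<mu>"

definition algebra_structure_W ::
  "('k::field, 'm::ab_group_add) graded_space \<Rightarrow> ('k, 'w::ab_group_add) graded_space \<Rightarrow>
     (('m \<times> 'w) list \<Rightarrow> 'm \<times> 'w) \<Rightarrow> bool" where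
  "algebra_structure_W M W \<delta> \<longleftrightarrow> \<delta> \<in> CW M W 2 \<and> codifferential (M \<uplus> W) \<delta>"

definition is_extension ::
  "('k::field, 'm::ab_group_add) graded_space \<Rightarrow> ('k, 'w::ab_group_add) graded_space \<Rightarrow>
     (('m \<times> 'w) list \<Rightarrow> 'm \<times> 'w) \<Rightarrow> (('m \<times> 'w) list \<Rightarrow> 'm \<times> 'w) \<Rightarrow>
     (('m \<times> 'w) list \<Rightarrow> 'm \<times> 'w) \<Rightarrow> (('m \<times> 'w) list \<Rightarrow> 'm \<times> 'w) \<Rightarrow> bool" where
  "is_extension M W \<delta> \<mu> lam \<psi> \<longleftrightarrow>
     lam \<in> CM M W 1 1 \<and> has_parity (M \<uplus> W) 1 lam \<and>
     \<psi> \<in> CM M W 0 2 \<and> has_parity (M \<uplus> W) 1 \<psi> \<and>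
     codifferential (M \<uplus> W) (\<delta> + \<mu> + lam + \<psi>)"


section \<open>Restricted equivalence\<close>

definition exp_map :: "(('m::ab_group_add \<times> 'w::zero) list \<Rightarrow> 'm \<times> 'w) \<Rightarrow> 'm \<times> 'w \<Rightarrow> 'm \<times> 'w" where
  "exp_map \<beta> = (\<lambda>(m, w). (m + fst (\<beta> [(0, w)]), w))"

definition G_rest ::
  "('k::field, 'm::ab_group_add) graded_space \<Rightarrow> ('k, 'w::ab_group_add) graded_space \<Rightarrow>
     ('m \<times> 'w \<Rightarrow> 'm \<times> 'w) set" where
  "G_rest M W = {exp_map \<beta> | \<beta>. \<beta> \<in> CM M W 0 1 \<and> has_parity (M \<uplus> W) 0 \<beta>}"

definition pullback :: "('v \<Rightarrow> 'v) \<Rightarrow> ('v list \<Rightarrow> 'v) \<Rightarrow> 'v list \<Rightarrow> 'v" where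
  "pullback f d = (\<lambda>vs. inv f (d (map f vs)))"

definition rest_class ::
  "('k::field, 'm::ab_group_add) graded_space \<Rightarrow> ('k, 'w::ab_group_add) graded_space \<Rightarrow>
     (('m \<times> 'w) list \<Rightarrow> 'm \<times> 'w) \<Rightarrow> (('m \<times> 'w) list \<Rightarrow> 'm \<times> 'w) set" where
  "rest_class M W d = (\<lambda>f. pullback f d) ` G_rest M W"


section \<open>Cohomology\<close>

text \<open>The quotient \<open>A / B\<close> is \<open>A // subquot A B\<close>, and the class of \<open>x\<close> is \<open>subquot A B `` {x}\<close>, which
  is the coset of \<open>x\<close> if \<open>x \<in> A\<close> and empty otherwise. This is also used when \<open>A\<close> and \<open>B\<close> are
  themselves sets of cosets, which are added elementwise.\<close>

definition subquot :: "'a::plus set \<Rightarrow> 'a set \<Rightarrow> ('a \<times> 'a) set" where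
  "subquot A B = {(x, y). x \<in> A \<and> y \<in> A \<and> (\<exists>b\<in>B. y = x + b)}"

definition cocycles ::
  "('k::field, 'm::ab_group_add) graded_space \<Rightarrow> ('k, 'w::ab_group_add) graded_space \<Rightarrow>
     (('m \<times> 'w) list \<Rightarrow> 'm \<times> 'w) \<Rightarrow> nat \<Rightarrow> nat \<Rightarrow> (('m \<times> 'w) list \<Rightarrow> 'm \<times> 'w) set" where
  "cocycles M W \<mu> k l = {\<phi> \<in> CM M W k l. bracket (M \<uplus> W) \<mu> \<phi> = 0}"

definition coboundaries ::
  "('k::field, 'm::ab_group_add) graded_space \<Rightarrow> ('k, 'w::ab_group_add) graded_space \<Rightarrow>
     (('m \<times> 'w) list \<Rightarrow> 'm \<times> 'w) \<Rightarrow> nat \<Rightarrow> nat \<Rightarrow> (('m \<times> 'w) list \<Rightarrow> 'm \<times> 'w) set" where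
  "coboundaries M W \<mu> k l = (if k = 0 then {0} else bracket (M \<uplus> W) \<mu> ` CM M W (k - 1) l)"

definition Hmu_class ::
  "('k::field, 'm::ab_group_add) graded_space \<Rightarrow> ('k, 'w::ab_group_add) graded_space \<Rightarrow>
     (('m \<times> 'w) list \<Rightarrow> 'm \<times> 'w) \<Rightarrow> nat \<Rightarrow> nat \<Rightarrow> (('m \<times> 'w) list \<Rightarrow> 'm \<times> 'w) \<Rightarrow>
     (('m \<times> 'w) list \<Rightarrow> 'm \<times> 'w) set" where
  "Hmu_class M W \<mu> k l \<phi> = subquot (cocycles M W \<mu> k l) (coboundaries M W \<mu> k l) `` {\<phi>}"

definition Hmu ::
  "('k::field, 'm::ab_group_add) graded_space \<Rightarrow> ('k, 'w::ab_group_add) graded_space \<Rightarrow>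
     (('m \<times> 'w) list \<Rightarrow> 'm \<times> 'w) \<Rightarrow> nat \<Rightarrow> nat \<Rightarrow> (('m \<times> 'w) list \<Rightarrow> 'm \<times> 'w) set set" where
  "Hmu M W \<mu> k l = cocycles M W \<mu> k l // subquot (cocycles M W \<mu> k l) (coboundaries M W \<mu> k l)"

text \<open>The class in $H_\mu^{1,2}(\ker D_\alpha)$, where $\alpha = \delta + \lambda$.\<close>

definition Hmu_ker_class ::
  "('k::field, 'm::ab_group_add) graded_space \<Rightarrow> ('k, 'w::ab_group_add) graded_space \<Rightarrow>
     (('m \<times> 'w) list \<Rightarrow> 'm \<times> 'w) \<Rightarrow> (('m \<times> 'w) list \<Rightarrow> 'm \<times> 'w) \<Rightarrow>
     (('m \<times> 'w) list \<Rightarrow> 'm \<times> 'w) \<Rightarrow> (('m \<times> 'w) list \<Rightarrow> 'm \<times> 'w) set" where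
  "Hmu_ker_class M W \<mu> \<alpha> \<phi> =
     subquot {\<phi> \<in> CM M W 1 2. bracket (M \<uplus> W) \<mu> \<phi> = 0 \<and> bracket (M \<uplus> W) \<alpha> \<phi> = 0}
             (bracket (M \<uplus> W) \<mu> ` {\<psi> \<in> CM M W 0 2. bracket (M \<uplus> W) \<alpha> \<psi> = 0}) `` {\<phi>}"

definition MC_condition ::
  "('k::field, 'm::ab_group_add) graded_space \<Rightarrow> ('k, 'w::ab_group_add) graded_space \<Rightarrow>
     (('m \<times> 'w) list \<Rightarrow> 'm \<times> 'w) \<Rightarrow> (('m \<times> 'w) list \<Rightarrow> 'm \<times> 'w) \<Rightarrow>
     (('m \<times> 'w) list \<Rightarrow> 'm \<times> 'w) \<Rightarrow> bool" where
  "MC_condition M W \<delta> \<mu> lam \<longleftrightarrow>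
     Hmu_ker_class M W \<mu> (\<delta> + lam) (bracket (M \<uplus> W) (\<delta> + lam) (\<delta> + lam))
     = Hmu_ker_class M W \<mu> (\<delta> + lam) 0"

text \<open>The map $H_\mu^{k,l} \to H_\mu^{k,l+1}$ induced by $D_\alpha$.\<close>

definition Dbar ::
  "('k::field, 'm::ab_group_add) graded_space \<Rightarrow> ('k, 'w::ab_group_add) graded_space \<Rightarrow>
     (('m \<times> 'w) list \<Rightarrow> 'm \<times> 'w) \<Rightarrow> (('m \<times> 'w) list \<Rightarrow> 'm \<times> 'w) \<Rightarrow> nat \<Rightarrow> nat \<Rightarrow>
     (('m \<times> 'w) list \<Rightarrow> 'm \<times> 'w) set \<Rightarrow> (('m \<times> 'w) list \<Rightarrow> 'm \<times> 'w) set" where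
  "Dbar M W \<mu> \<alpha> k l c = (\<Union>\<phi>\<in>c. Hmu_class M W \<mu> k (l + 1) (bracket (M \<uplus> W) \<alpha> \<phi>))"

definition Dbar_kernel ::
  "('k::field, 'm::ab_group_add) graded_space \<Rightarrow> ('k, 'w::ab_group_add) graded_space \<Rightarrow>
     (('m \<times> 'w) list \<Rightarrow> 'm \<times> 'w) \<Rightarrow> (('m \<times> 'w) list \<Rightarrow> 'm \<times> 'w) \<Rightarrow> nat \<Rightarrow> nat \<Rightarrow>
     (('m \<times> 'w) list \<Rightarrow> 'm \<times> 'w) set set" where
  "Dbar_kernel M W \<mu> \<alpha> k l =
     {c \<in> Hmu M W \<mu> k l. Dbar M W \<mu> \<alpha> k l c = Hmu_class M W \<mu> k (l + 1) 0}"

text \<open>$H_{\mu,\alpha}^{0,2}$, where $\alpha = \delta + \lambda$; \<open>H02_class\<close> sends $\tau$ to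
  $[\bar\tau]$, and \<open>H02_odd\<close> consists of the classes of odd cochains.\<close>

definition H02_rel ::
  "('k::field, 'm::ab_group_add) graded_space \<Rightarrow> ('k, 'w::ab_group_add) graded_space \<Rightarrow>
     (('m \<times> 'w) list \<Rightarrow> 'm \<times> 'w) \<Rightarrow> (('m \<times> 'w) list \<Rightarrow> 'm \<times> 'w) \<Rightarrow>
     ((('m \<times> 'w) list \<Rightarrow> 'm \<times> 'w) set \<times> (('m \<times> 'w) list \<Rightarrow> 'm \<times> 'w) set) set" where
  "H02_rel M W \<mu> \<alpha> = subquot (Dbar_kernel M W \<mu> \<alpha> 0 2) (Dbar M W \<mu> \<alpha> 0 1 ` Hmu M W \<mu> 0 1)"

definition H02 ::
  "('k::field, 'm::ab_group_add) graded_space \<Rightarrow> ('k, 'w::ab_group_add) graded_space \<Rightarrow>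
     (('m \<times> 'w) list \<Rightarrow> 'm \<times> 'w) \<Rightarrow> (('m \<times> 'w) list \<Rightarrow> 'm \<times> 'w) \<Rightarrow>
     (('m \<times> 'w) list \<Rightarrow> 'm \<times> 'w) set set set" where
  "H02 M W \<mu> \<alpha> = Dbar_kernel M W \<mu> \<alpha> 0 2 // H02_rel M W \<mu> \<alpha>"

definition H02_class ::
  "('k::field, 'm::ab_group_add) graded_space \<Rightarrow> ('k, 'w::ab_group_add) graded_space \<Rightarrow>
     (('m \<times> 'w) list \<Rightarrow> 'm \<times> 'w) \<Rightarrow> (('m \<times> 'w) list \<Rightarrow> 'm \<times> 'w) \<Rightarrow>
     (('m \<times> 'w) list \<Rightarrow> 'm \<times> 'w) \<Rightarrow> (('m \<times> 'w) list \<Rightarrow> 'm \<times> 'w) set set" where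
  "H02_class M W \<mu> \<alpha> \<tau> = H02_rel M W \<mu> \<alpha> `` {Hmu_class M W \<mu> 0 2 \<tau>}"

definition H02_odd ::
  "('k::field, 'm::ab_group_add) graded_space \<Rightarrow> ('k, 'w::ab_group_add) graded_space \<Rightarrow>
     (('m \<times> 'w) list \<Rightarrow> 'm \<times> 'w) \<Rightarrow> (('m \<times> 'w) list \<Rightarrow> 'm \<times> 'w) \<Rightarrow>
     (('m \<times> 'w) list \<Rightarrow> 'm \<times> 'w) set set set" where
  "H02_odd M W \<mu> \<alpha> =
     {c \<in> H02 M W \<mu> \<alpha>.
        \<exists>\<tau> \<in> CM M W 0 2. has_parity (M \<uplus> W) 1 \<tau> \<and> c = H02_class M W \<mu> \<alpha> \<tau>}"

end

theory Submission
  imports Defs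
begin

text \<open>Put \<open>\<alpha> = \<delta> + \<lambda>\<close>. Sorting \<open>[d, d]\<close> for \<open>d = \<mu> + \<alpha> + \<psi>\<close> by the types
  (2,1), (1,2), (0,3) gives \<open>[\<mu>, \<lambda>] = 0\<close>, \<open>[\<alpha>, \<alpha>] + 2 [\<mu>, \<psi>] = 0\<close> and \<open>[\<alpha>, \<psi>] = 0\<close>.
  An even \<open>\<beta>\<close> in $C^{0,1}$ acts on extensions by
  $\lambda \mapsto \lambda + [\mu, \beta]$ and
  $\psi \mapsto \psi + [\alpha, \beta] + \frac12 [[\mu, \beta], \beta]$, where the quadratic term
  vanishes once \<open>[\<mu>, \<beta>] = 0\<close>. So \<open>\<lambda>\<close> may move exactly within its class; with \<open>\<lambda>\<close> fixed, two
  solutions \<open>\<psi>\<close> differ by a \<open>\<tau>\<close> killed by \<open>[\<mu>, _]\<close> and \<open>[\<alpha>, _]\<close>, up to \<open>[\<alpha>, \<beta>]\<close> with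
  \<open>[\<mu>, \<beta>] = 0\<close>. Cochains of mixed parity that occur as primitives are replaced by their
  homogeneous parts. The only Jacobi identity needed is \<open>[d, [d, d]] = 0\<close> for odd binary \<open>d\<close>.\<close>

text \<open>Cochains are multilinear on lists of each length, so identities are tested on lists of
  homogeneous vectors when parity matters, and on lists with entries in \<open>M\<close> or
  \<open>W\<close> when types matter. A composite vanishes as soon as the outer map has no slot of
  the kind in which the inner one takes values. This is why \<open>exp_map \<beta>\<close> is the
  identity plus \<beta>, and why only \<mu> contributes a term of order two in \<beta>: it is
  \<mu>(\<beta> a, \<beta> b), which [[\<mu>, \<beta>], \<beta>] counts twice. The equations for a
  transformed pair, [\<mu>, [\<mu>, \<beta>]] = 0 among them, are read off from the conjugated
  codifferential. Parity is the main obstacle: the cohomology groups are built from all cochains,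
  the group only from even \<beta>. Bracketing with an odd cochain shifts parity by one, so it maps
  parity parts to parity parts, and a primitive of a homogeneous element can be cut down to one of
  its parts. The factor 2 enters twice: [d, d] is twice d composed with itself, and the
  cohomological condition asks for a primitive of -[\<alpha>, \<alpha>], while 2 \<psi> has to be
  one; so \<psi> is half the odd part of the primitive.\<close>

section \<open>Graded vector spaces and the bracket\<close>

text \<open>These two rewrite sums and products of parities into terms with \<open>of_bool\<close>.\<close>

declare add_bit_eq_xor [simp del] mult_bit_eq_and [simp del]

lemma sg_simps [simp]: "sg 0 x = x" "sg 1 x = - x"
  by (simp_all add: sg_def)

locale graded =
  fixes V :: "('k::field, 'v::ab_group_add) graded_space"
  assumes graded: "graded_vector_space V"
begin

sublocale vs: vector_space "smult V"
  using graded by (simp add: graded_vector_space_def)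

abbreviation lin :: "('v \<Rightarrow> 'v) \<Rightarrow> bool" where
  "lin \<equiv> Vector_Spaces.linear (smult V) (smult V)"

lemma lin_iff:
  "lin f \<longleftrightarrow> (\<forall>x y. f (x + y) = f x + f y) \<and> (\<forall>c x. f (smult V c x) = smult V c (f x))"
  using vs.vector_space_axioms Vector_Spaces.linear_iff[of "smult V" "smult V" f]
  by simp

lemma lin_sum: "(\<And>i. i \<in> I \<Longrightarrow> lin (f i)) \<Longrightarrow> lin (\<lambda>x. \<Sum>i\<in>I. f i x)"
  by (simp add: lin_iff sum.distrib vs.scale_sum_right)

lemma subspace_homog: "vs.subspace (homog V p)"
  using graded by (simp add: graded_vector_space_def)

lemmas homog_zero = vs.subspace_0[OF subspace_homog]
  and homog_add = vs.subspace_add[OF subspace_homog]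
  and homog_neg = vs.subspace_neg[OF subspace_homog]
  and homog_scale = vs.subspace_scale[OF subspace_homog]
  and homog_sum = vs.subspace_sum[OF subspace_homog]

lemma homog_sg: "x \<in> homog V q \<Longrightarrow> sg p x \<in> homog V q"
  by (cases p) (simp_all add: homog_neg)

text \<open>Only parity 0 is covered by the definition; for parity 1 the component is the complement
  \<open>v - x\<close> of the even one.\<close>

lemma ex1_hpart: "\<exists>!x. x \<in> homog V p \<and> v - x \<in> homog V (p + 1)"
proof -
  have ex1: "\<exists>!x. x \<in> homog V 0 \<and> v - x \<in> homog V 1"
    using graded by (simp add: graded_vector_space_def)
  show ?thesis
  proof (cases "p = 0")
    case True
    then show ?thesis using ex1 by simp
  next
    case False
    then have p: "p = 1" by simp
    from ex1 obtain x where x: "x \<in> homog V 0" "v - x \<in> homog V 1"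
      and u: "\<And>y. y \<in> homog V 0 \<Longrightarrow> v - y \<in> homog V 1 \<Longrightarrow> y = x" by blast
    show ?thesis
    proof (intro ex1I[of _ "v - x"] conjI)
      show "v - x \<in> homog V p" "v - (v - x) \<in> homog V (p + 1)" using x p by simp_all
      fix y assume y: "y \<in> homog V p \<and> v - y \<in> homog V (p + 1)"
      have "v - y = x" by (rule u) (use y p in simp_all)
      then show "y = v - x" by auto
    qed
  qed
qed

lemma hpart_in: "hpart V p v \<in> homog V p"
  and hpart_compl: "v - hpart V p v \<in> homog V (p + 1)"
  using theI'[OF ex1_hpart[of p v]] by (simp_all add: hpart_def)

lemma hpart_eqI: "x \<in> homog V p \<Longrightarrow> v - x \<in> homog V (p + 1) \<Longrightarrow> hpart V p v = x"
  using ex1_hpart[of p v] hpart_in[of p v] hpart_compl[of v p] by blast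

lemma hpart_sum: "hpart V 0 v + hpart V 1 v = v"
proof -
  have "hpart V 1 v = v - hpart V 0 v"
    using hpart_in[of 0 v] hpart_compl[of v 0] by (intro hpart_eqI) simp_all
  then show ?thesis by simp
qed

lemma lin_hpart: "lin (hpart V p)"
  unfolding lin_iff
proof (intro conjI allI)
  fix x y
  have "x + y - (hpart V p x + hpart V p y) = (x - hpart V p x) + (y - hpart V p y)" by simp
  also have "\<dots> \<in> homog V (p + 1)" by (intro homog_add hpart_compl)
  finally show "hpart V p (x + y) = hpart V p x + hpart V p y"
    by (intro hpart_eqI homog_add hpart_in)
next
  fix c x
  have "smult V c x - smult V c (hpart V p x) = smult V c (x - hpart V p x)"
    by (simp add: vs.scale_right_diff_distrib)
  also have "\<dots> \<in> homog V (p + 1)" by (intro homog_scale hpart_compl)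
  finally show "hpart V p (smult V c x) = smult V c (hpart V p x)"
    by (intro hpart_eqI homog_scale hpart_in)
qed

lemma hpart_homog: "v \<in> homog V q \<Longrightarrow> hpart V p v = (if p = q then v else 0)"
  by (cases p; cases q) (auto intro!: hpart_eqI simp: homog_zero)

lemma lin_twist: "lin (twist V p)"
  using lin_hpart unfolding lin_iff twist_def
  by (cases p) (simp_all add: vs.scale_right_distrib vs.scale_right_diff_distrib)

lemmas twist_add = lin_twist[unfolded lin_iff, THEN conjunct1, rule_format]
  and twist_scale = lin_twist[unfolded lin_iff, THEN conjunct2, rule_format]

lemma twist_zero [simp]: "twist V p 0 = 0"
  using twist_scale[of p 0 0] by simp

lemma twist_minus [simp]: "twist V p (- x) = - twist V p x"
  using twist_scale[of p "-1" x] by simp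

lemma twist_0 [simp]: "twist V 0 v = v"
  by (simp add: twist_def hpart_sum)

lemma twist_homog: "v \<in> homog V q \<Longrightarrow> twist V p v = sg (p * q) v"
  by (cases p; cases q) (simp_all add: twist_def hpart_homog)

lemma twist_in: "v \<in> homog V q \<Longrightarrow> twist V p v \<in> homog V q"
  by (simp add: twist_homog homog_sg)

lemma twist_twist [simp]: "twist V p (twist V p v) = v"
proof -
  have "twist V p (twist V p (hpart V q v)) = hpart V q v" for q
    by (simp only: twist_homog[OF hpart_in] twist_homog[OF homog_sg[OF hpart_in]])
      (cases p; cases q; simp)
  from this[of 0] this[of 1] have
    "twist V p (twist V p (hpart V 0 v + hpart V 1 v)) = hpart V 0 v + hpart V 1 v"
    by (simp add: twist_add)
  then show ?thesis by (simp add: hpart_sum)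
qed

section \<open>Cochains as multilinear maps\<close>

lemma cochains_linear: "\<phi> \<in> cochains V \<Longrightarrow> lin (\<lambda>x. \<phi> (us @ x # vs))"
  by (simp add: cochains_def)

lemma cochains_iff:
  "\<phi> \<in> cochains V \<longleftrightarrow>
     (\<forall>us x y vs. \<phi> (us @ (x + y) # vs) = \<phi> (us @ x # vs) + \<phi> (us @ y # vs)) \<and>
     (\<forall>us c x vs. \<phi> (us @ smult V c x # vs) = smult V c (\<phi> (us @ x # vs)))"
  by (auto simp: cochains_def lin_iff)

lemma cochains_add: "\<phi> \<in> cochains V \<Longrightarrow> \<phi> (us @ (x + y) # vs) = \<phi> (us @ x # vs) + \<phi> (us @ y # vs)"
  and cochains_scale: "\<phi> \<in> cochains V \<Longrightarrow> \<phi> (us @ smult V c x # vs) = smult V c (\<phi> (us @ x # vs))"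
  by (simp_all add: cochains_iff)

lemma cochains_zero: "\<phi> \<in> cochains V \<Longrightarrow> \<phi> (us @ 0 # vs) = 0"
  using cochains_scale[of \<phi> us 0 0 vs] by simp

lemma cochains_minus: "\<phi> \<in> cochains V \<Longrightarrow> \<phi> (us @ (- x) # vs) = - \<phi> (us @ x # vs)"
  using cochains_scale[of \<phi> us "-1" x vs] by simp

lemma cochains_sg: "\<phi> \<in> cochains V \<Longrightarrow> \<phi> (us @ sg p x # vs) = sg p (\<phi> (us @ x # vs))"
  by (cases p) (simp_all add: cochains_minus)

text \<open>Slots are expanded one at a time by additivity. Two summands per vector serve both uses:
  even plus odd, and \<open>M\<close> plus \<open>W\<close>.\<close>

lemma cochains_eqI:
  assumes \<phi>: "\<phi> \<in> cochains V" and \<chi>: "\<chi> \<in> cochains V"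
    and S: "\<And>v. \<exists>x\<in>S. \<exists>y\<in>S. v = x + y"
    and eq: "\<And>vs. set vs \<subseteq> S \<Longrightarrow> \<phi> vs = \<chi> vs"
  shows "\<phi> = \<chi>"
proof
  fix ws
  \<comment> \<open>The prefix \<open>us\<close> holds the slots already specialised to
    \<open>S\<close>, the suffix \<open>vs\<close> those still to be split.\<close>
  have "set us \<subseteq> S \<Longrightarrow> \<phi> (us @ vs) = \<chi> (us @ vs)" for us vs
  proof (induction vs arbitrary: us)
    case Nil
    then show ?case using eq by simp
  next
    case (Cons v vs)
    obtain x y where xy: "x \<in> S" "y \<in> S" "v = x + y" using S by blast
    have "\<phi> (us @ z # vs) = \<chi> (us @ z # vs)" if "z \<in> S" for z
      using Cons.IH[of "us @ [z]"] Cons.prems that by simp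
    then show ?case using xy by (simp add: cochains_add[OF \<phi>] cochains_add[OF \<chi>])
  qed
  from this[of "[]" ws] show "\<phi> ws = \<chi> ws" by simp
qed

lemma homog_spans: "\<exists>x\<in>\<Union>(range (homog V)). \<exists>y\<in>\<Union>(range (homog V)). v = x + y"
  using hpart_in[of 0 v] hpart_in[of 1 v] hpart_sum[of v] by (metis UN_iff UNIV_I)

lemma homog_list: "set vs \<subseteq> \<Union>(range (homog V)) \<Longrightarrow> \<exists>qs. list_all2 (\<lambda>v q. v \<in> homog V q) vs qs"
  by (induction vs) (auto simp: list_all2_Cons1)

lemma cochains_0: "0 \<in> cochains V"
  and cochains_plus: "\<phi> \<in> cochains V \<Longrightarrow> \<chi> \<in> cochains V \<Longrightarrow> \<phi> + \<chi> \<in> cochains V"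
  and cochains_uminus: "\<phi> \<in> cochains V \<Longrightarrow> - \<phi> \<in> cochains V"
  and cochains_smult: "\<phi> \<in> cochains V \<Longrightarrow> (\<lambda>vs. smult V c (\<phi> vs)) \<in> cochains V"
  by (auto simp: cochains_iff vs.scale_right_distrib mult.commute)

lemma cochains_comp:
  assumes "\<phi> \<in> cochains V" "lin f" "lin g"
  shows "(\<lambda>vs. f (\<phi> (map g vs))) \<in> cochains V"
  using assms by (auto simp: cochains_iff lin_iff)

lemma has_parity_0: "has_parity V p 0"
  and has_parity_plus: "has_parity V p \<phi> \<Longrightarrow> has_parity V p \<chi> \<Longrightarrow> has_parity V p (\<phi> + \<chi>)"
  and has_parity_uminus: "has_parity V p \<phi> \<Longrightarrow> has_parity V p (- \<phi>)"
  and has_parity_smult: "has_parity V p \<phi> \<Longrightarrow> has_parity V p (\<lambda>vs. smult V c (\<phi> vs))"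
  unfolding has_parity_def by (simp_all add: homog_zero homog_add homog_scale homog_neg)

lemma cochains_diff: "\<phi> \<in> cochains V \<Longrightarrow> \<chi> \<in> cochains V \<Longrightarrow> \<phi> - \<chi> \<in> cochains V"
  using cochains_plus[of \<phi> "- \<chi>"] cochains_uminus by simp

lemma has_parity_diff: "has_parity V p \<phi> \<Longrightarrow> has_parity V p \<chi> \<Longrightarrow> has_parity V p (\<phi> - \<chi>)"
  using has_parity_plus[of p \<phi> "- \<chi>"] has_parity_uminus by simp

lemma cochains_sg_fun: "\<phi> \<in> cochains V \<Longrightarrow> sg p \<phi> \<in> cochains V"
  and has_parity_sg: "has_parity V q \<phi> \<Longrightarrow> has_parity V q (sg p \<phi>)"
  by (cases p; simp add: cochains_uminus has_parity_uminus)+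

lemma circ_cochains:
  assumes \<phi>: "\<phi> \<in> cochains V" and \<chi>: "\<chi> \<in> cochains V"
  shows "circ V q \<phi> \<chi> \<in> cochains V"
proof -
  have lin: "lin (\<lambda>x. \<phi> (map (twist V q) (take i (us @ x # ws)) @
      \<chi> (take l (drop i (us @ x # ws))) # drop (i + l) (us @ x # ws)))"
    (is "lin (?F i l)")
    if "i + l \<le> length us + Suc (length ws)" for us ws i l
  proof -
    \<comment> \<open>The free slot \<open>x\<close> lies in the twisted front, in the block fed to
      \<chi>, or in the tail.\<close>
    consider "length us < i" | "i \<le> length us" "length us < i + l" | "i + l \<le> length us"
      by linarith
    then show ?thesis
    proof cases
      case 1
      then obtain k where k: "i = length us + Suc k" by (metis add_Suc_right less_iff_Suc_add)
      have "?F i l = (\<lambda>x. \<phi> (map (twist V q) us @ twist V q x #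
          (map (twist V q) (take k ws) @ \<chi> (take l (drop k ws)) # drop (k + l) ws)))"
        by (simp add: k)
      then show ?thesis
        by (simp add: lin_iff twist_add twist_scale cochains_add[OF \<phi>] cochains_scale[OF \<phi>])
    next
      case 2
      then obtain k where k: "i + l = length us + Suc k" by (metis add_Suc_right less_iff_Suc_add)
      have l: "l - (length us - i) = Suc k" "i - length us = 0"
        and "i + l - length us = Suc k" using k 2 by linarith+
      then have "?F i l = (\<lambda>x. \<phi> (map (twist V q) (take i us) @
          \<chi> (drop i us @ x # take k ws) # drop k ws))"
        using 2 by (simp add: drop_Cons')
      then show ?thesis
        by (simp add: lin_iff cochains_add[OF \<phi>] cochains_scale[OF \<phi>]
            cochains_add[OF \<chi>] cochains_scale[OF \<chi>])
    next
      case 3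
      then have "?F i l = (\<lambda>x. \<phi> ((map (twist V q) (take i us) @
          \<chi> (take l (drop i us)) # drop (i + l) us) @ x # ws))"
        by simp
      then show ?thesis
        using cochains_linear[OF \<phi>] by (simp only:)
    qed
  qed
  have "lin (\<lambda>x. circ V q \<phi> \<chi> (us @ x # ws))" for us ws
  proof -
    have "lin (\<lambda>x. \<Sum>l\<le>length us + Suc (length ws). \<Sum>i\<le>length us + Suc (length ws) - l.
        \<phi> (map (twist V q) (take i (us @ x # ws)) @
          \<chi> (take l (drop i (us @ x # ws))) # drop (i + l) (us @ x # ws)))"
      by (intro lin_sum lin) auto
    then show ?thesis by (simp add: circ_def del: take_append drop_append)
  qed
  then show ?thesis by (simp add: cochains_def)
qed

text \<open>Twisting changes only signs and so preserves homogeneity; hence parities add for every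
  \<open>r\<close>.\<close>

lemma has_parity_circ:
  assumes \<phi>: "has_parity V p \<phi>" and \<chi>: "has_parity V q \<chi>"
  shows "has_parity V (p + q) (circ V r \<phi> \<chi>)"
  unfolding has_parity_def
proof (intro allI impI)
  fix vs qs assume vs: "list_all2 (\<lambda>v q. v \<in> homog V q) vs qs"
  show "circ V r \<phi> \<chi> vs \<in> homog V (p + q + sum_list qs)"
    unfolding circ_def
  proof (intro homog_sum)
    fix l i
    \<comment> \<open>The block consumed by \<chi> becomes a single entry, of parity
      \<open>q\<close> plus the sum over the block.\<close>
    let ?qs = "take i qs @ (q + sum_list (take l (drop i qs))) # drop (i + l) qs"
    have "list_all2 (\<lambda>v q. v \<in> homog V q) (map (twist V r) (take i vs)) (take i qs)"
      unfolding list_all2_map1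
      by (rule list_all2_mono[OF list_all2_takeI[OF vs]]) (rule twist_in)
    moreover have "\<chi> (take l (drop i vs)) \<in> homog V (q + sum_list (take l (drop i qs)))"
      using \<chi> vs unfolding has_parity_def by (blast intro: list_all2_takeI list_all2_dropI)
    moreover have "list_all2 (\<lambda>v q. v \<in> homog V q) (drop (i + l) vs) (drop (i + l) qs)"
      using vs by (rule list_all2_dropI)
    ultimately have "list_all2 (\<lambda>v q. v \<in> homog V q)
        (map (twist V r) (take i vs) @ \<chi> (take l (drop i vs)) # drop (i + l) vs) ?qs"
      by (intro list_all2_appendI) simp_all
    then have "\<phi> (map (twist V r) (take i vs) @ \<chi> (take l (drop i vs)) # drop (i + l) vs)
        \<in> homog V (p + sum_list ?qs)"
      using \<phi> unfolding has_parity_def by blast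
    moreover have "qs = take i qs @ take l (drop i qs) @ drop (i + l) qs"
      by (metis append_take_drop_id drop_drop add.commute)
    then have "sum_list qs = sum_list (take i qs) + (sum_list (take l (drop i qs)) + sum_list (drop (i + l) qs))"
      by (metis sum_list_append)
    then have "p + sum_list ?qs = p + q + sum_list qs" by (simp add: ac_simps)
    then have "p + q + sum_list qs = p + sum_list ?qs" ..
    ultimately show "\<phi> (map (twist V r) (take i vs) @ \<chi> (take l (drop i vs)) # drop (i + l) vs)
        \<in> homog V (p + q + sum_list qs)" by (simp only:)
  qed
qed

lemma circ_plus_left: "circ V q (\<phi> + \<phi>') \<chi> = circ V q \<phi> \<chi> + circ V q \<phi>' \<chi>"
  by (simp add: circ_def fun_eq_iff sum.distrib)

lemma circ_plus_right:
  "\<phi> \<in> cochains V \<Longrightarrow> circ V q \<phi> (\<chi> + \<chi>') = circ V q \<phi> \<chi> + circ V q \<phi> \<chi>'"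
  by (simp add: circ_def fun_eq_iff cochains_add sum.distrib)

lemma circ_0_left [simp]: "circ V q 0 \<chi> = 0"
  by (simp add: circ_def fun_eq_iff)

lemma circ_0_right [simp]: "\<phi> \<in> cochains V \<Longrightarrow> circ V q \<phi> 0 = 0"
  by (simp add: circ_def fun_eq_iff cochains_zero)

section \<open>Parity components\<close>

lemma map_twist_parity:
  assumes \<phi>: "\<phi> \<in> cochains V" and vs: "list_all2 (\<lambda>v q. v \<in> homog V q) vs qs"
  shows "\<phi> (map (twist V 1) vs) = sg (sum_list qs) (\<phi> vs)"
proof -
  \<comment> \<open>The prefix is arbitrary, so that the induction can pass a still twisted entry
    into it; the sign of that entry is extracted afterwards.\<close>
  have "\<phi> (us @ map (twist V 1) vs) = sg (sum_list qs) (\<phi> (us @ vs))" for us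
    using vs
  proof (induction vs qs arbitrary: us rule: list_all2_induct)
    case (Cons v vs q qs)
    from Cons.IH[of "us @ [twist V 1 v]"]
    have "\<phi> (us @ map (twist V 1) (v # vs)) = sg (sum_list qs) (\<phi> (us @ twist V 1 v # vs))" by simp
    also have "\<dots> = sg (sum_list qs) (sg q (\<phi> (us @ v # vs)))"
      using Cons.hyps by (simp add: twist_homog cochains_sg[OF \<phi>])
    also have "\<dots> = sg (sum_list (q # qs)) (\<phi> (us @ v # vs))"
      by (cases q; cases "sum_list qs") simp_all
    finally show ?case .
  qed simp
  from this[of "[]"] show ?thesis by simp
qed

text \<open>On homogeneous arguments of total parity s the arguments contribute the sign of s and
  the value that of p + s; together this is the sign of p.\<close>

lemma twist_parity:
  assumes "\<phi> \<in> cochains V" "has_parity V p \<phi>"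
  shows "(\<lambda>vs. twist V 1 (\<phi> (map (twist V 1) vs))) = sg p \<phi>"
proof (rule cochains_eqI[OF _ _ homog_spans])
  show "(\<lambda>vs. twist V 1 (\<phi> (map (twist V 1) vs))) \<in> cochains V"
    using cochains_comp[OF assms(1) lin_twist lin_twist] .
  show "sg p \<phi> \<in> cochains V" using assms(1) by (rule cochains_sg_fun)
  fix vs assume "set vs \<subseteq> \<Union>(range (homog V))"
  then obtain qs where qs: "list_all2 (\<lambda>v q. v \<in> homog V q) vs qs" using homog_list by blast
  then have "\<phi> vs \<in> homog V (p + sum_list qs)" using assms(2) by (simp add: has_parity_def)
  then have "twist V 1 (\<phi> vs) = sg (p + sum_list qs) (\<phi> vs)"
    by (simp add: twist_homog)
  then show "twist V 1 (\<phi> (map (twist V 1) vs)) = sg p \<phi> vs"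
    unfolding map_twist_parity[OF assms(1) qs] by (cases p; cases "sum_list qs"; simp)
qed

lemma parity_part_cochains: "\<phi> \<in> cochains V \<Longrightarrow> parity_part V p \<phi> \<in> cochains V"
proof -
  assume \<phi>: "\<phi> \<in> cochains V"
  have "(\<phi> + sg p (\<lambda>vs. twist V 1 (\<phi> (map (twist V 1) vs)))) \<in> cochains V"
    by (intro cochains_plus cochains_sg_fun \<phi> cochains_comp lin_twist)
  from cochains_smult[OF this, of "1/2"] show ?thesis
    by (cases p) (simp_all add: parity_part_def)
qed

lemma parity_part_plus: "parity_part V p (\<phi> + \<chi>) = parity_part V p \<phi> + parity_part V p \<chi>"
  by (cases p) (simp_all add: parity_part_def fun_eq_iff twist_add vs.scale_right_distrib algebra_simps)

lemma parity_part_zero [simp]: "parity_part V p 0 = 0"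
  using parity_part_plus[of p 0 0] by simp

end

text \<open>Division by 2 makes \<open>parity_part\<close> a projection and turns [d, d] = 0 into
  \<open>circ V 1 d d = 0\<close> for odd d.\<close>

locale graded2 = graded +
  assumes two_neq_zero: "(2::'a) \<noteq> 0"
begin

lemma smult_half [simp]: "smult V (1 / 2) (x + x) = x"
proof -
  have "smult V (1 / 2) (x + x) = smult V (1 / 2 + 1 / 2) x"
    by (simp only: vs.scale_left_distrib vs.scale_right_distrib)
  also have "(1 / 2 + 1 / 2 :: 'a) = 1" using two_neq_zero by (simp add: field_simps)
  finally show ?thesis by simp
qed

lemma double_eq_zero: "x + x = 0 \<Longrightarrow> x = (0::'b)"
  using smult_half[of x] by simp

lemma parity_part_parity:
  assumes "\<phi> \<in> cochains V" "has_parity V p \<phi>"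
  shows "parity_part V q \<phi> = (if q = p then \<phi> else 0)"
proof -
  have "twist V 1 (\<phi> (map (twist V 1) vs)) = sg p (\<phi> vs)" for vs
    using fun_cong[OF twist_parity[OF assms], of vs] by (cases p) simp_all
  then show ?thesis
    unfolding parity_part_def fun_eq_iff by (cases q; cases p) simp_all
qed

text \<open>On homogeneous arguments of total parity s the average defining
  \<open>parity_part\<close> is the projection of the value of \<phi> to parity q + s.\<close>

lemma has_parity_parity_part:
  assumes "\<phi> \<in> cochains V"
  shows "has_parity V q (parity_part V q \<phi>)"
  unfolding has_parity_def
proof (intro allI impI)
  fix vs qs assume qs: "list_all2 (\<lambda>v q. v \<in> homog V q) vs qs"
  have "parity_part V q \<phi> vs =
      smult V (1 / 2) (\<phi> vs + sg (q + sum_list qs) (twist V 1 (\<phi> vs)))"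
    unfolding parity_part_def map_twist_parity[OF assms qs]
    by (cases q; cases "sum_list qs") simp_all
  also have "\<dots> = hpart V (q + sum_list qs) (\<phi> vs)"
  proof -
    have "\<phi> vs + sg s (twist V 1 (\<phi> vs)) = hpart V s (\<phi> vs) + hpart V s (\<phi> vs)" for s
      using hpart_sum[of "\<phi> vs"] by (cases s) (auto simp: twist_def algebra_simps)
    then show ?thesis by simp
  qed
  finally show "parity_part V q \<phi> vs \<in> homog V (q + sum_list qs)"
    by (simp add: hpart_in)
qed

lemma parity_part_sum: "parity_part V 0 \<phi> + parity_part V 1 \<phi> = \<phi>"
  by (simp add: parity_part_def fun_eq_iff flip: vs.scale_right_distrib)

text \<open>A homogeneous cochain equals one of its parity parts and the other is zero, so a single
  summand of the fourfold sum is left.\<close>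

lemma bracket_parity:
  assumes "\<phi> \<in> cochains V" "has_parity V p \<phi>" "\<chi> \<in> cochains V" "has_parity V q \<chi>"
  shows "bracket V \<phi> \<chi> = circ V q \<phi> \<chi> - sg (p * q) (circ V p \<chi> \<phi>)"
  using assms by (cases p; cases q) (simp_all add: bracket_def parity_part_parity)

lemma bracket_plus_left:
  assumes "\<phi> \<in> cochains V" "\<phi>' \<in> cochains V" "\<chi> \<in> cochains V"
  shows "bracket V (\<phi> + \<phi>') \<chi> = bracket V \<phi> \<chi> + bracket V \<phi>' \<chi>"
  using assms by (simp add: bracket_def parity_part_plus circ_plus_left circ_plus_right
      parity_part_cochains)

lemma bracket_plus_right:
  assumes "\<phi> \<in> cochains V" "\<chi> \<in> cochains V" "\<chi>' \<in> cochains V"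
  shows "bracket V \<phi> (\<chi> + \<chi>') = bracket V \<phi> \<chi> + bracket V \<phi> \<chi>'"
  using assms by (simp add: bracket_def parity_part_plus circ_plus_left circ_plus_right
      parity_part_cochains)

lemma bracket_0_right: "\<phi> \<in> cochains V \<Longrightarrow> bracket V \<phi> 0 = 0"
  by (simp add: bracket_def parity_part_cochains)

lemma bracket_diff_right:
  assumes "\<phi> \<in> cochains V" "\<chi> \<in> cochains V" "\<chi>' \<in> cochains V"
  shows "bracket V \<phi> (\<chi> - \<chi>') = bracket V \<phi> \<chi> - bracket V \<phi> \<chi>'"
  using bracket_plus_right[OF assms(1) cochains_diff[OF assms(2,3)] assms(3)] by (simp add: eq_diff_eq)

lemma has_parity_bracket:
  assumes "\<phi> \<in> cochains V" "has_parity V p \<phi>" "\<chi> \<in> cochains V" "has_parity V q \<chi>"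
  shows "has_parity V (p + q) (bracket V \<phi> \<chi>)"
  using has_parity_circ[OF assms(2,4)] has_parity_circ[OF assms(4,2)]
  by (simp add: bracket_parity[OF assms] has_parity_diff has_parity_sg add.commute)

lemma bracket_cochains:
  assumes "\<phi> \<in> cochains V" "has_parity V p \<phi>" "\<chi> \<in> cochains V" "has_parity V q \<chi>"
  shows "bracket V \<phi> \<chi> \<in> cochains V"
  by (simp add: bracket_parity[OF assms] circ_cochains cochains_diff cochains_sg_fun assms)

lemma bracket_odd_commute:
  assumes "\<phi> \<in> cochains V" "has_parity V 1 \<phi>" "\<chi> \<in> cochains V" "has_parity V 1 \<chi>"
  shows "bracket V \<phi> \<chi> = bracket V \<chi> \<phi>"
  using assms by (simp add: bracket_parity)

text \<open>Bracketing with \<phi> shifts parity by \<open>p\<close>, so it respects the splitting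
  of \<chi>. This is what allows a primitive of mixed parity to be replaced by a homogeneous
  one.\<close>

lemma bracket_parity_part:
  assumes \<phi>: "\<phi> \<in> cochains V" "has_parity V p \<phi>" and \<chi>: "\<chi> \<in> cochains V"
  shows "bracket V \<phi> (parity_part V q \<chi>) = parity_part V (p + q) (bracket V \<phi> \<chi>)"
proof -
  let ?\<chi> = "\<lambda>r. parity_part V r \<chi>"
  note B = \<phi> parity_part_cochains[OF \<chi>] has_parity_parity_part[OF \<chi>]
  have "bracket V \<phi> \<chi> = bracket V \<phi> (?\<chi> 0) + bracket V \<phi> (?\<chi> 1)"
    using bracket_plus_right[of \<phi> "?\<chi> 0" "?\<chi> 1"] B by (simp add: parity_part_sum)
  then show ?thesis
    by (simp add: parity_part_plus parity_part_parity[OF bracket_cochains[OF B] has_parity_bracket[OF B]])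
qed

end

section \<open>Cochains on a direct sum\<close>

lemma pure_tensors_Nil: "[] \<in> pure_tensors i j \<longleftrightarrow> i = 0 \<and> j = 0"
  by (auto simp: pure_tensors_def)

lemma pure_tensors_Cons:
  "v # vs \<in> pure_tensors i j \<longleftrightarrow>
     (\<exists>m i'. v = (m, 0) \<and> i = Suc i' \<and> vs \<in> pure_tensors i' j) \<or>
     (\<exists>w j'. v = (0, w) \<and> j = Suc j' \<and> vs \<in> pure_tensors i j')"
  (is "?L \<longleftrightarrow> ?R")
proof
  assume ?L
  then obtain xs where xs: "v # vs = map (case_sum (\<lambda>m. (m, 0)) (\<lambda>w. (0, w))) xs"
      "length (filter isl xs) = i" "length (filter (\<lambda>x. \<not> isl x) xs) = j"
    unfolding pure_tensors_def mem_Collect_eq by metis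
  then obtain y ys where "xs = y # ys" by (cases xs) auto
  with xs show ?R by (cases y) (auto simp: pure_tensors_def)
next
  assume ?R
  then consider m i' xs where "v = (m, 0)" "i = Suc i'"
      "vs = map (case_sum (\<lambda>m. (m, 0)) (\<lambda>w. (0, w))) xs"
      "length (filter isl xs) = i'" "length (filter (\<lambda>x. \<not> isl x) xs) = j"
    | w j' xs where "v = (0, w)" "j = Suc j'"
      "vs = map (case_sum (\<lambda>m. (m, 0)) (\<lambda>w. (0, w))) xs"
      "length (filter isl xs) = i" "length (filter (\<lambda>x. \<not> isl x) xs) = j'"
    unfolding pure_tensors_def by blast
  then show ?L
  proof cases
    case 1
    then show ?thesis unfolding pure_tensors_def by (intro CollectI exI[of _ "Inl m # xs"]) auto
  next
    case 2
    then show ?thesis unfolding pure_tensors_def by (intro CollectI exI[of _ "Inr w # xs"]) auto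
  qed
qed

lemma pure_tensors_length: "vs \<in> pure_tensors i j \<Longrightarrow> length vs = i + j"
  by (induction vs arbitrary: i j) (auto simp: pure_tensors_Nil pure_tensors_Cons)

lemma pure_tensors_append:
  "us \<in> pure_tensors i j \<Longrightarrow> vs \<in> pure_tensors k l \<Longrightarrow> us @ vs \<in> pure_tensors (i + k) (j + l)"
  by (induction us arbitrary: i j) (fastforce simp: pure_tensors_Nil pure_tensors_Cons)+

text \<open>A zero entry may be counted in \<open>M\<close> or in \<open>W\<close>, so a list can
  have several types; the splitting follows the given one.\<close>

lemma pure_tensors_appendE:
  assumes "us @ vs \<in> pure_tensors i j"
  obtains i1 j1 i2 j2 where "us \<in> pure_tensors i1 j1" "vs \<in> pure_tensors i2 j2" "i = i1 + i2" "j = j1 + j2"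
proof -
  have "\<exists>i1 j1 i2 j2. us \<in> pure_tensors i1 j1 \<and> vs \<in> pure_tensors i2 j2 \<and> i = i1 + i2 \<and> j = j1 + j2"
    using assms
  proof (induction us arbitrary: i j)
    case Nil
    then show ?case
      by (intro exI[of _ 0] exI[of _ 0] exI[of _ i] exI[of _ j]) (simp add: pure_tensors_Nil)
  next
    case (Cons v us)
    from Cons.prems consider m i' where "v = (m, 0)" "i = Suc i'" "us @ vs \<in> pure_tensors i' j"
      | w j' where "v = (0, w)" "j = Suc j'" "us @ vs \<in> pure_tensors i j'"
      by (auto simp: pure_tensors_Cons)
    then show ?case
    proof cases
      case 1
      from Cons.IH[OF 1(3)] obtain i1 j1 i2 j2 where
        "us \<in> pure_tensors i1 j1" "vs \<in> pure_tensors i2 j2" "i' = i1 + i2" "j = j1 + j2" by blast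
      then show ?thesis using 1
        by (intro exI[of _ "Suc i1"] exI[of _ j1] exI[of _ i2] exI[of _ j2])
          (auto simp: pure_tensors_Cons)
    next
      case 2
      from Cons.IH[OF 2(3)] obtain i1 j1 i2 j2 where
        "us \<in> pure_tensors i1 j1" "vs \<in> pure_tensors i2 j2" "i = i1 + i2" "j' = j1 + j2" by blast
      then show ?thesis using 2
        by (intro exI[of _ i1] exI[of _ "Suc j1"] exI[of _ i2] exI[of _ j2])
          (auto simp: pure_tensors_Cons)
    qed
  qed
  then show ?thesis using that by blast
qed

abbreviation pure_vectors :: "('m::zero \<times> 'w::zero) set" where
  "pure_vectors \<equiv> range (\<lambda>m. (m, 0)) \<union> range (\<lambda>w. (0, w))"

lemma pure_tensors_exist: "set vs \<subseteq> pure_vectors \<Longrightarrow> \<exists>i j. vs \<in> pure_tensors i j"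
proof (induction vs)
  case Nil
  then show ?case by (simp add: pure_tensors_Nil)
next
  case (Cons v vs)
  then show ?case by (auto simp: pure_tensors_Cons)
qed

lemma pure_vectors_span:
  "\<exists>x\<in>pure_vectors. \<exists>y\<in>pure_vectors. v = x + (y :: 'm::monoid_add \<times> 'w::monoid_add)"
  by (intro bexI[of _ "(fst v, 0)"] bexI[of _ "(0, snd v)"]) (simp_all add: prod_eq_iff)

section \<open>The direct sum as a graded space\<close>

locale graded_pair = M: graded M + W: graded W
  for M :: "('k::field, 'm::ab_group_add) graded_space"
    and W :: "('k, 'w::ab_group_add) graded_space" +
  assumes two: "(2::'k) \<noteq> 0"
begin

sublocale vector_space_prod "smult M" "smult W"
  by unfold_locales

lemma smult_pair: "smult (M \<uplus> W) c (m, w) = (smult M c m, smult W c w)"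
  by (simp add: direct_sum_def scale_prod)

lemma homog_pair: "homog (M \<uplus> W) p = homog M p \<times> homog W p"
  by (simp add: direct_sum_def)

lemma graded_direct_sum: "graded_vector_space (M \<uplus> W)"
proof -
  have "\<exists>!x. x \<in> homog M 0 \<times> homog W 0 \<and> v - x \<in> homog M 1 \<times> homog W 1" for v
  proof -
    obtain m w where v: "v = (m, w)" by (cases v)
    show ?thesis
    proof (intro ex1I conjI)
      show "(hpart M 0 m, hpart W 0 w) \<in> homog M 0 \<times> homog W 0"
        by (simp add: M.hpart_in W.hpart_in)
      show "v - (hpart M 0 m, hpart W 0 w) \<in> homog M 1 \<times> homog W 1"
        using M.hpart_compl[of m 0] W.hpart_compl[of w 0] by (simp add: v)
      fix x assume x: "x \<in> homog M 0 \<times> homog W 0 \<and> v - x \<in> homog M 1 \<times> homog W 1"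
      obtain m' w' where "x = (m', w')" by (cases x)
      then show "x = (hpart M 0 m, hpart W 0 w)"
        using x M.hpart_eqI[of m' 0 m] W.hpart_eqI[of w' 0 w] by (simp add: v)
    qed
  qed
  then show ?thesis
    by (simp add: graded_vector_space_def direct_sum_def p.vector_space_axioms
        subspace_Times M.subspace_homog W.subspace_homog)
qed

sublocale graded2 "M \<uplus> W"
  by unfold_locales (simp_all add: graded_direct_sum two)

lemma hpart_pair: "hpart (M \<uplus> W) p (m, w) = (hpart M p m, hpart W p w)"
  by (rule hpart_eqI)
    (simp_all add: homog_pair M.hpart_in W.hpart_in M.hpart_compl W.hpart_compl)

lemma twist_pair: "twist (M \<uplus> W) p (m, w) = (twist M p m, twist W p w)"
  by (cases p) (simp_all add: twist_def hpart_pair)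

lemma map_twist_pure: "vs \<in> pure_tensors i j \<Longrightarrow> map (twist (M \<uplus> W) p) vs \<in> pure_tensors i j"
  by (induction vs arbitrary: i j) (fastforce simp: pure_tensors_Nil pure_tensors_Cons twist_pair)+

lemma cochains_eq_0I:
  assumes "\<phi> \<in> cochains (M \<uplus> W)" "\<And>i j vs. vs \<in> pure_tensors i j \<Longrightarrow> \<phi> vs = 0"
  shows "\<phi> = 0"
proof (rule cochains_eqI[OF assms(1) cochains_0 pure_vectors_span])
  fix vs :: "('m \<times> 'w) list" assume "set vs \<subseteq> pure_vectors"
  then obtain i j where "vs \<in> pure_tensors i j" using pure_tensors_exist by blast
  then show "\<phi> vs = 0 vs" by (simp add: assms(2))
qed

section \<open>Supports and the types of composites\<close>

abbreviation supp :: "nat \<Rightarrow> nat \<Rightarrow> (('m \<times> 'w) list \<Rightarrow> 'm \<times> 'w) set" where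
  "supp \<equiv> supported_cochains M W"

lemma suppD: "\<phi> \<in> supp k l \<Longrightarrow> \<phi> \<in> cochains (M \<uplus> W)"
  and supp_vanish: "\<phi> \<in> supp k l \<Longrightarrow> vs \<in> pure_tensors i j \<Longrightarrow> (i, j) \<noteq> (k, l) \<Longrightarrow> \<phi> vs = 0"
  by (auto simp: supported_cochains_def)

lemma suppI:
  "\<phi> \<in> cochains (M \<uplus> W) \<Longrightarrow> (\<And>i j vs. vs \<in> pure_tensors i j \<Longrightarrow> \<phi> vs \<noteq> 0 \<Longrightarrow> i = k \<and> j = l)
    \<Longrightarrow> \<phi> \<in> supp k l"
  by (auto simp: supported_cochains_def)

text \<open>Supports are prescribed on pure tensors only; multilinearity carries the vanishing over
  to all lists of the wrong length.\<close>

lemma supp_length: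
  assumes "\<phi> \<in> supp k l" "length vs \<noteq> k + l"
  shows "\<phi> vs = 0"
proof -
  \<comment> \<open>The truncation is again a cochain, because multilinearity is a condition on each
    length separately, and it agrees with \<phi> on pure tensors.\<close>
  have "\<phi> = (\<lambda>vs. if length vs = k + l then \<phi> vs else 0)"
  proof (rule cochains_eqI[OF suppD[OF assms(1)] _ pure_vectors_span])
    show "(\<lambda>vs. if length vs = k + l then \<phi> vs else 0) \<in> cochains (M \<uplus> W)"
      using suppD[OF assms(1)] by (simp add: cochains_iff)
  next
    fix vs :: "('m \<times> 'w) list" assume "set vs \<subseteq> pure_vectors"
    then obtain i j where "vs \<in> pure_tensors i j" using pure_tensors_exist by blast
    then show "\<phi> vs = (if length vs = k + l then \<phi> vs else 0)"
      using supp_vanish[OF assms(1)] pure_tensors_length by fastforce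
  qed
  then have "\<phi> vs = (if length vs = k + l then \<phi> vs else 0)" by (rule fun_cong)
  then show ?thesis using assms(2) by simp
qed

text \<open>Conservation of types: \<chi> consumes k' entries from \<open>M\<close> and l' from
  \<open>W\<close> and returns one entry of type (a, b), which is (1, 0) for values in
  \<open>M\<close> and (0, 1) for values in \<open>W\<close>. Together with the (i0, j0) untouched
  entries this must fill the slots of \<phi>.\<close>

lemma circ_supp:
  assumes \<phi>: "\<phi> \<in> supp k l" and \<chi>: "\<chi> \<in> supp k' l'"
    and out: "\<And>vs. [\<chi> vs] \<in> pure_tensors a b"
    and vs: "vs \<in> pure_tensors i j" and neq: "circ (M \<uplus> W) q \<phi> \<chi> vs \<noteq> 0"
  shows "\<exists>i0 j0. i = k' + i0 \<and> j = l' + j0 \<and> i0 + a = k \<and> j0 + b = l"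
proof -
  obtain n s where ns:
    "\<phi> (map (twist (M \<uplus> W) q) (take s vs) @ \<chi> (take n (drop s vs)) # drop (s + n) vs) \<noteq> 0"
    using neq unfolding circ_def by (meson sum.not_neutral_contains_not_neutral)
  have "vs = take s vs @ (take n (drop s vs) @ drop (s + n) vs)"
    by (metis append_take_drop_id drop_drop add.commute)
  with vs have "take s vs @ (take n (drop s vs) @ drop (s + n) vs) \<in> pure_tensors i j" by simp
  then obtain i1 j1 i' j' where 1: "take s vs \<in> pure_tensors i1 j1"
    and "take n (drop s vs) @ drop (s + n) vs \<in> pure_tensors i' j'"
    and ij': "i = i1 + i'" "j = j1 + j'"
    by (rule pure_tensors_appendE)
  from this(2) obtain i2 j2 i3 j3 where 2: "take n (drop s vs) \<in> pure_tensors i2 j2"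
    and 3: "drop (s + n) vs \<in> pure_tensors i3 j3" and "i' = i2 + i3" "j' = j2 + j3"
    by (rule pure_tensors_appendE)
  with ij' have ij: "i = i1 + i2 + i3" "j = j1 + j2 + j3" by simp_all
  have "(i2, j2) = (k', l')"
  proof (rule ccontr)
    assume "(i2, j2) \<noteq> (k', l')"
    then have "\<chi> (take n (drop s vs)) = 0" using supp_vanish[OF \<chi> 2] by blast
    then show False using ns by (simp add: cochains_zero[OF suppD[OF \<phi>]])
  qed
  moreover have "map (twist (M \<uplus> W) q) (take s vs) @ [\<chi> (take n (drop s vs))] @ drop (s + n) vs
      \<in> pure_tensors (i1 + (a + i3)) (j1 + (b + j3))"
    by (intro pure_tensors_append map_twist_pure 1 3 out)
  with ns have "(i1 + (a + i3), j1 + (b + j3)) = (k, l)"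
    using supp_vanish[OF \<phi>] by force
  ultimately show ?thesis
    by (intro exI[of _ "i1 + i3"] exI[of _ "j1 + j3"]) (auto simp: ij)
qed

lemma CM_iff: "\<phi> \<in> CM M W k l \<longleftrightarrow> \<phi> \<in> supp k l \<and> (\<forall>vs. snd (\<phi> vs) = 0)"
  by (simp add: CM_def)

lemma CM_supp: "\<phi> \<in> CM M W k l \<Longrightarrow> \<phi> \<in> supp k l"
  and CM_snd: "\<phi> \<in> CM M W k l \<Longrightarrow> snd (\<phi> vs) = 0"
  and CM_cochains: "\<phi> \<in> CM M W k l \<Longrightarrow> \<phi> \<in> cochains (M \<uplus> W)"
  by (auto simp: CM_def dest: suppD)

lemma CM_out: "\<phi> \<in> CM M W k l \<Longrightarrow> [\<phi> vs] \<in> pure_tensors 1 0"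
  by (cases "\<phi> vs") (use CM_snd[of \<phi> k l vs] in \<open>auto simp: pure_tensors_Cons pure_tensors_Nil\<close>)

lemma CW_supp: "\<phi> \<in> CW M W n \<Longrightarrow> \<phi> \<in> supp 0 n"
  and CW_cochains: "\<phi> \<in> CW M W n \<Longrightarrow> \<phi> \<in> cochains (M \<uplus> W)"
  by (auto simp: CW_def dest: suppD)

lemma CW_out: "\<phi> \<in> CW M W n \<Longrightarrow> [\<phi> vs] \<in> pure_tensors 0 1"
  by (cases "\<phi> vs") (auto simp: CW_def pure_tensors_Cons pure_tensors_Nil dest: spec[of _ vs])

lemma CM_0: "0 \<in> CM M W k l"
  and CM_plus: "\<phi> \<in> CM M W k l \<Longrightarrow> \<chi> \<in> CM M W k l \<Longrightarrow> \<phi> + \<chi> \<in> CM M W k l"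
  and CM_uminus: "\<phi> \<in> CM M W k l \<Longrightarrow> - \<phi> \<in> CM M W k l"
  by (auto simp: CM_def supported_cochains_def cochains_0 cochains_plus cochains_uminus)

lemma CM_diff: "\<phi> \<in> CM M W k l \<Longrightarrow> \<chi> \<in> CM M W k l \<Longrightarrow> \<phi> - \<chi> \<in> CM M W k l"
  using CM_plus[of \<phi> k l "- \<chi>"] CM_uminus by simp

lemma CM_sg: "\<phi> \<in> CM M W k l \<Longrightarrow> sg p \<phi> \<in> CM M W k l"
  by (cases p) (simp_all add: CM_uminus)

lemma CM_smult: "\<phi> \<in> CM M W k l \<Longrightarrow> (\<lambda>vs. smult (M \<uplus> W) c (\<phi> vs)) \<in> CM M W k l"
proof -
  have "snd (smult (M \<uplus> W) c v) = smult W c (snd v)" for v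
    by (cases v) (simp add: smult_pair)
  then show "\<phi> \<in> CM M W k l \<Longrightarrow> (\<lambda>vs. smult (M \<uplus> W) c (\<phi> vs)) \<in> CM M W k l"
    by (auto simp: CM_def supported_cochains_def cochains_smult)
qed

text \<open>The parity involution preserves both summands, so averaging over it preserves
  types.\<close>

lemma CM_parity_part:
  assumes "\<phi> \<in> CM M W k l"
  shows "parity_part (M \<uplus> W) p \<phi> \<in> CM M W k l"
proof -
  let ?T = "twist (M \<uplus> W) 1"
  have "(\<lambda>vs. ?T (\<phi> (map ?T vs))) \<in> CM M W k l"
    unfolding CM_iff
  proof (intro conjI allI suppI cochains_comp[OF CM_cochains[OF assms]] lin_twist)
    fix vs i j assume "vs \<in> pure_tensors i j" "?T (\<phi> (map ?T vs)) \<noteq> 0"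
    then have "\<phi> (map ?T vs) \<noteq> 0" "map ?T vs \<in> pure_tensors i j"
      by (auto simp: map_twist_pure)
    then show "i = k" "j = l" using supp_vanish[OF CM_supp[OF assms]] by blast+
  next
    fix vs
    show "snd (?T (\<phi> (map ?T vs))) = 0"
      using CM_snd[OF assms, of "map ?T vs"] by (cases "\<phi> (map ?T vs)") (simp add: twist_pair)
  qed
  from CM_smult[OF CM_plus[OF assms CM_sg[OF this, of p]], of "1 / 2"]
  show ?thesis by (cases p) (simp_all add: parity_part_def)
qed

text \<open>The value of \<chi> fills one slot in \<open>M\<close>, so n is k + k' - 1. For k = k' =
  0 there is no such slot, and \<open>circ_supp_CM_eq_0\<close> applies.\<close>

lemma circ_CM:
  assumes \<phi>: "\<phi> \<in> CM M W k l" and \<chi>: "\<chi> \<in> CM M W k' l'" and n: "k + k' = Suc n"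
  shows "circ (M \<uplus> W) q \<phi> \<chi> \<in> CM M W n (l + l')"
  unfolding CM_iff
proof (intro conjI allI suppI circ_cochains CM_cochains[OF \<phi>] CM_cochains[OF \<chi>])
  fix i j vs assume "vs \<in> pure_tensors i j" "circ (M \<uplus> W) q \<phi> \<chi> vs \<noteq> 0"
  from circ_supp[OF CM_supp[OF \<phi>] CM_supp[OF \<chi>] CM_out[OF \<chi>] this] n
  show "i = n" "j = l + l'" by auto
qed (simp add: circ_def snd_sum CM_snd[OF \<phi>])

lemma circ_CM_CW:
  assumes \<phi>: "\<phi> \<in> CM M W k l" and \<chi>: "\<chi> \<in> CW M W (Suc n)"
  shows "circ (M \<uplus> W) q \<phi> \<chi> \<in> CM M W k (l + n)"
  unfolding CM_iff
proof (intro conjI allI suppI circ_cochains CM_cochains[OF \<phi>] CW_cochains[OF \<chi>])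
  fix i j vs assume "vs \<in> pure_tensors i j" "circ (M \<uplus> W) q \<phi> \<chi> vs \<noteq> 0"
  from circ_supp[OF CM_supp[OF \<phi>] CW_supp[OF \<chi>] CW_out[OF \<chi>] this]
  show "i = k" "j = l + n" by auto
qed (simp add: circ_def snd_sum CM_snd[OF \<phi>])

text \<open>No slot of \<phi> accepts the values of \<chi>, which lie in \<open>M\<close>. The next
  lemma exchanges the summands.\<close>

lemma circ_supp_CM_eq_0:
  assumes "\<phi> \<in> supp 0 n" "\<chi> \<in> CM M W k l"
  shows "circ (M \<uplus> W) q \<phi> \<chi> = 0"
proof (rule cochains_eq_0I[OF circ_cochains[OF suppD[OF assms(1)] CM_cochains[OF assms(2)]]])
  fix i j and vs :: "('m \<times> 'w) list" assume vs: "vs \<in> pure_tensors i j"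
  show "circ (M \<uplus> W) q \<phi> \<chi> vs = 0"
    using circ_supp[OF assms(1) CM_supp[OF assms(2)] CM_out[OF assms(2)] vs] by fastforce
qed

lemma circ_supp_CW_eq_0:
  assumes "\<phi> \<in> supp n 0" "\<chi> \<in> CW M W l"
  shows "circ (M \<uplus> W) q \<phi> \<chi> = 0"
proof (rule cochains_eq_0I[OF circ_cochains[OF suppD[OF assms(1)] CW_cochains[OF assms(2)]]])
  fix i j and vs :: "('m \<times> 'w) list" assume vs: "vs \<in> pure_tensors i j"
  show "circ (M \<uplus> W) q \<phi> \<chi> vs = 0"
    using circ_supp[OF assms(1) CW_supp[OF assms(2)] CW_out[OF assms(2)] vs] by fastforce
qed

lemma bracket_CM:
  assumes "\<phi> \<in> CM M W k l" "has_parity (M \<uplus> W) p \<phi>"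
    and "\<chi> \<in> CM M W k' l'" "has_parity (M \<uplus> W) q \<chi>" and "k + k' = Suc n"
  shows "bracket (M \<uplus> W) \<phi> \<chi> \<in> CM M W n (l + l')"
  using assms circ_CM[OF assms(1,3,5)] circ_CM[OF assms(3,1), of n]
  by (simp add: bracket_parity CM_cochains CM_diff CM_sg add.commute)

text \<open>Since \<delta> accepts no entry from \<open>M\<close>, only the composite with \<delta>
  inside \<chi> survives.\<close>

lemma bracket_CW_CM:
  assumes "\<delta> \<in> CW M W (Suc n)" "has_parity (M \<uplus> W) p \<delta>"
    and "\<chi> \<in> CM M W k l" "has_parity (M \<uplus> W) q \<chi>"
  shows "bracket (M \<uplus> W) \<delta> \<chi> \<in> CM M W k (l + n)"
  using assms circ_CM_CW[OF assms(3,1)] circ_supp_CM_eq_0[OF CW_supp[OF assms(1)] assms(3)]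
  by (simp add: bracket_parity CM_cochains CW_cochains CM_uminus CM_sg)

lemma CM_Int_eq_0:
  assumes "\<phi> \<in> CM M W k l" "\<phi> \<in> CM M W k' l'" "(k, l) \<noteq> (k', l')"
  shows "\<phi> = 0"
  by (rule cochains_eq_0I[OF CM_cochains[OF assms(1)]])
    (metis CM_supp assms supp_vanish)

end

section \<open>Compositions of low arity\<close>

context graded
begin

lemma twist_cochain:
  assumes "\<phi> \<in> cochains V" "has_parity V p \<phi>"
  shows "twist V 1 (\<phi> vs) = sg p (\<phi> (map (twist V 1) vs))"
  using fun_cong[OF twist_parity[OF assms], of "map (twist V 1) vs"]
  by (cases p) (simp_all add: comp_def)

lemma circ_arity:
  assumes "\<phi> \<in> cochains V" and "\<And>vs. length vs \<noteq> l \<Longrightarrow> \<chi> vs = 0"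
  shows "circ V q \<phi> \<chi> vs = (if l \<le> length vs then \<Sum>i\<le>length vs - l.
     \<phi> (map (twist V q) (take i vs) @ \<chi> (take l (drop i vs)) # drop (i + l) vs) else 0)"
proof -
  let ?F = "\<lambda>l'. \<Sum>i\<le>length vs - l'.
     \<phi> (map (twist V q) (take i vs) @ \<chi> (take l' (drop i vs)) # drop (i + l') vs)"
  have "?F l' = 0" if "l' \<le> length vs" "l' \<noteq> l" for l'
    using that by (auto intro!: sum.neutral simp: assms(2) cochains_zero[OF assms(1)])
  then have "(\<Sum>l'\<le>length vs. ?F l') = (\<Sum>l'\<le>length vs. if l' = l then ?F l else 0)"
    by (intro sum.cong) auto
  then show ?thesis by (simp add: circ_def)
qed

lemma circ_arity_sum:
  assumes "\<phi> \<in> cochains V" and "\<And>vs. length vs \<noteq> l \<Longrightarrow> \<chi> vs = 0" and "length vs = n + l"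
  shows "circ V q \<phi> \<chi> vs = (\<Sum>i\<le>n.
     \<phi> (map (twist V q) (take i vs) @ \<chi> (take l (drop i vs)) # drop (i + l) vs))"
  using assms(3) by (simp add: circ_arity[OF assms(1,2)])

lemma circ_arity_eq_0:
  assumes "\<phi> \<in> cochains V" and "\<And>vs. length vs \<noteq> k \<Longrightarrow> \<phi> vs = 0"
    and "\<And>vs. length vs \<noteq> l \<Longrightarrow> \<chi> vs = 0" and "Suc (length vs) \<noteq> k + l"
  shows "circ V q \<phi> \<chi> vs = 0"
  using assms(4) by (auto simp: circ_arity[OF assms(1,3)] intro!: sum.neutral assms(2))

lemma length_2E: assumes "length vs = 2" obtains a b where "vs = [a, b]"
  using assms by (auto simp: length_Suc_conv numeral_2_eq_2)

lemma cochains_add_2: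
  assumes "\<phi> \<in> cochains V"
  shows "\<phi> [x + y, b] = \<phi> [x, b] + \<phi> [y, b]" "\<phi> [a, x + y] = \<phi> [a, x] + \<phi> [a, y]"
  using cochains_add[OF assms, of "[]"] cochains_add[OF assms, of "[a]"] by auto

lemma cochains_minus_2:
  assumes "\<phi> \<in> cochains V"
  shows "\<phi> [- x, b] = - \<phi> [x, b]" "\<phi> [a, - x] = - \<phi> [a, x]"
  using cochains_minus[OF assms, of "[]"] cochains_minus[OF assms, of "[a]"] by auto

lemma circ_2_1:
  assumes "\<phi> \<in> cochains V" and "\<And>vs. length vs \<noteq> 1 \<Longrightarrow> \<chi> vs = 0"
  shows "circ V q \<phi> \<chi> [a, b] = \<phi> [\<chi> [a], b] + \<phi> [twist V q a, \<chi> [b]]"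
  using circ_arity_sum[where n = 1 and vs = "[a, b]", OF assms] by simp

lemma circ_1_2:
  assumes "\<phi> \<in> cochains V" and "\<And>vs. length vs \<noteq> 2 \<Longrightarrow> \<chi> vs = 0"
  shows "circ V q \<phi> \<chi> [a, b] = \<phi> [\<chi> [a, b]]"
  using circ_arity_sum[where n = 0 and vs = "[a, b]", OF assms] by simp

text \<open>Written out on four arguments, the nested terms of both sides agree. The right side has
  two further terms, with \<open>d [a, b]\<close> and \<open>d [c, e]\<close> side by side; they
  cancel because twisting the value \<open>d [a, b]\<close> gives the negative of \<open>d\<close>
  on the twisted \<open>a\<close> and \<open>b\<close>.\<close>

lemma circ_circ_odd:
  assumes d: "d \<in> cochains V" "has_parity V 1 d" and ar: "\<And>vs. length vs \<noteq> 2 \<Longrightarrow> d vs = 0"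
  shows "circ V 0 d (circ V 1 d d) = circ V 1 (circ V 1 d d) d"
proof
  fix vs
  let ?y = "circ V 1 d d"
  have y: "?y \<in> cochains V" using d(1) d(1) by (rule circ_cochains)
  have ary: "?y vs = 0" if "length vs \<noteq> 3" for vs
    using that by (intro circ_arity_eq_0[OF d(1) ar ar]) auto
  have y3: "?y [a, b, c] = d [d [a, b], c] + d [twist V 1 a, d [b, c]]" for a b c
    using circ_arity_sum[where n = 1 and vs = "[a, b, c]", OF d(1) ar] by (simp add: numeral_2_eq_2)
  show "circ V 0 d ?y vs = circ V 1 ?y d vs"
  proof (cases "length vs = 4")
    case True
    then obtain a b c e where vs: "vs = [a, b, c, e]"
      by (auto simp: length_Suc_conv numeral_eq_Suc)
    have 1: "circ V 0 d ?y vs = d [?y [a, b, c], e] + d [a, ?y [b, c, e]]"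
      using circ_arity_sum[where n = 1 and vs = vs, OF d(1) ary] by (simp add: vs numeral_3_eq_3)
    have 2: "circ V 1 ?y d vs =
        ?y [d [a, b], c, e] + ?y [twist V 1 a, d [b, c], e] + ?y [twist V 1 a, twist V 1 b, d [c, e]]"
      using circ_arity_sum[where n = "Suc 1" and vs = vs, OF y ar] by (simp add: vs numeral_2_eq_2)
    show ?thesis
      by (simp add: 1 2 y3 cochains_add_2[OF d(1)] cochains_minus_2[OF d(1)] twist_cochain[OF d])
  next
    case False
    then show ?thesis
      using circ_arity_eq_0[where vs = vs, OF d(1) ar ary]
        circ_arity_eq_0[where vs = vs, OF y ary ar] by simp
  qed
qed

text \<open>The map \<open>f\<close> applied to the arguments of the outer cochain cancels its
  inverse around the value of \<chi>.\<close>

lemma circ_pullback: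
  assumes f: "\<And>v. g (f v) = v" "\<And>v. f (g v) = v" and g: "lin g"
    and tw: "\<And>v. f (twist V q v) = twist V q (f v)"
  shows "circ V q (pullback f \<phi>) (pullback f \<chi>) = pullback f (circ V q \<phi> \<chi>)"
proof
  fix vs
  have inv: "inv f = g" using f by (rule inv_equality)
  have "g 0 = 0" using g unfolding lin_iff by (metis vs.scale_zero_left)
  then have sum: "g (sum h A) = (\<Sum>x\<in>A. g (h x))" for h and A :: "nat set"
    using g by (induction A rule: infinite_finite_induct) (simp_all add: lin_iff)
  have tw': "map f (map (twist V q) vs) = map (twist V q) (map f vs)" for vs
    by (simp add: tw)
  show "circ V q (pullback f \<phi>) (pullback f \<chi>) vs = pullback f (circ V q \<phi> \<chi>) vs"
    by (simp add: circ_def pullback_def inv sum f take_map drop_map tw' del: map_map)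
qed

end

context graded2
begin

text \<open>[d, d] is twice the even cochain \<open>circ V 1 d d\<close>, whose bracket with
  \<open>d\<close> is the difference of the two sides of \<open>circ_circ_odd\<close>.\<close>

lemma bracket_bracket_odd:
  assumes d: "d \<in> cochains V" "has_parity V 1 d" and ar: "\<And>vs. length vs \<noteq> 2 \<Longrightarrow> d vs = 0"
  shows "bracket V d (bracket V d d) = 0"
proof -
  let ?y = "circ V 1 d d"
  have y: "?y \<in> cochains V" "has_parity V 0 ?y"
    using circ_cochains[OF d(1) d(1)] has_parity_circ[OF d(2) d(2)] by simp_all
  have "bracket V d ?y = 0"
    using circ_circ_odd[OF assms] by (simp add: bracket_parity[OF d y])
  moreover have "bracket V d d = ?y + ?y" by (simp add: bracket_parity[OF d d])
  ultimately show ?thesis by (simp add: bracket_plus_right[OF d(1) y(1) y(1)])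
qed

text \<open>For odd d the condition amounts to \<open>circ V 1 d d = 0\<close>, which is invariant
  under conjugation by a graded automorphism.\<close>

lemma codifferential_pullback:
  assumes d: "codifferential V d"
    and f: "\<And>v. g (f v) = v" "\<And>v. f (g v) = v" "lin f" "lin g"
    and hom: "\<And>p v. v \<in> homog V p \<Longrightarrow> f v \<in> homog V p" "\<And>p v. v \<in> homog V p \<Longrightarrow> g v \<in> homog V p"
  shows "codifferential V (pullback f d)"
proof -
  have d': "d \<in> cochains V" "has_parity V 1 d" "bracket V d d = 0"
    using d by (simp_all add: codifferential_def)
  have inv: "inv f = g" using f(1,2) by (rule inv_equality)
  \<comment> \<open>Preserving parities, \<open>f\<close> commutes with the homogeneous projections
    and hence with the Koszul twist.\<close>
  have tw: "f (twist V q v) = twist V q (f v)" for q v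
  proof -
    have "hpart V p (f v) = f (hpart V p v)" for p
    proof (rule hpart_eqI[OF hom(1)[OF hpart_in]])
      have "f (v - hpart V p v) = f v - f (hpart V p v)"
        using f(3) unfolding lin_iff by (metis add_diff_cancel_right' diff_add_cancel)
      then show "f v - f (hpart V p v) \<in> homog V (p + 1)" using hom(1)[OF hpart_compl] by metis
    qed
    moreover have minus: "f (- x) = - f x" for x
      using f(3)[unfolded lin_iff, THEN conjunct2, rule_format, of "-1" x] by simp
    moreover have "f (x - y) = f x - f y" for x y
      using f(3)[unfolded lin_iff, THEN conjunct1, rule_format, of x "- y"] by (simp add: minus)
    ultimately show ?thesis using f(3) by (cases q) (simp_all add: twist_def lin_iff)
  qed
  have pc: "pullback f d \<in> cochains V"
    unfolding pullback_def inv by (rule cochains_comp[OF d'(1) f(4,3)])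
  have pp: "has_parity V 1 (pullback f d)"
    using d'(2) hom unfolding has_parity_def pullback_def inv
    by (simp add: list_all2_map1 list_all2_mono)
  have "circ V 1 d d + circ V 1 d d = 0"
    using bracket_parity[OF d'(1,2,1,2)] d'(3) by simp
  then have "circ V 1 d d = 0" by (auto simp: fun_eq_iff intro: double_eq_zero)
  moreover have "g 0 = 0" using f(4) unfolding lin_iff by (metis vs.scale_zero_left)
  ultimately have "circ V 1 (pullback f d) (pullback f d) = 0"
    using circ_pullback[OF f(1,2,4) tw, of 1 d d] by (simp add: pullback_def inv fun_eq_iff)
  then show ?thesis
    by (simp add: codifferential_def pc pp bracket_parity[OF pc pp pc pp])
qed

lemma double_fun_eq_zero: "\<phi> + \<phi> = 0 \<Longrightarrow> \<phi> = (0 :: 'b list \<Rightarrow> 'b)"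
  by (auto simp: fun_eq_iff intro: double_eq_zero)

end

section \<open>Extensions\<close>

locale extension_data = graded_pair M W
  for M :: "('k::field, 'm::ab_group_add) graded_space"
    and W :: "('k, 'w::ab_group_add) graded_space" +
  fixes \<delta> \<mu> :: "('m \<times> 'w) list \<Rightarrow> 'm \<times> 'w"
  assumes \<delta>: "algebra_structure_W M W \<delta>" and \<mu>: "algebra_structure_M M W \<mu>"
begin

abbreviation "br \<equiv> bracket (M \<uplus> W)"
abbreviation "parity \<equiv> has_parity (M \<uplus> W)"

lemma \<delta>_CW: "\<delta> \<in> CW M W 2" and \<delta>_odd: "parity 1 \<delta>" and \<delta>_\<delta>: "br \<delta> \<delta> = 0"
  and \<delta>_cochain: "\<delta> \<in> cochains (M \<uplus> W)"
  using \<delta> by (auto simp: algebra_structure_W_def codifferential_def)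

lemma \<mu>_CM: "\<mu> \<in> CM M W 2 0" and \<mu>_odd: "parity 1 \<mu>" and \<mu>_\<mu>: "br \<mu> \<mu> = 0"
  and \<mu>_cochain: "\<mu> \<in> cochains (M \<uplus> W)"
  using \<mu> by (auto simp: algebra_structure_M_def codifferential_def)

text \<open>Neither cochain has a slot for the values of the other.\<close>

lemma \<mu>_\<delta>: "br \<mu> \<delta> = 0"
  using circ_supp_CW_eq_0[OF CM_supp[OF \<mu>_CM] \<delta>_CW] circ_supp_CM_eq_0[OF CW_supp[OF \<delta>_CW] \<mu>_CM]
  by (simp add: bracket_parity[OF \<mu>_cochain \<mu>_odd \<delta>_cochain \<delta>_odd])

lemma bracket_\<psi>_\<psi>:
  assumes "\<psi> \<in> CM M W 0 n" "parity p \<psi>" "\<psi>' \<in> CM M W 0 m" "parity q \<psi>'"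
  shows "br \<psi> \<psi>' = 0"
  using circ_supp_CM_eq_0[OF CM_supp[OF assms(1)] assms(3)]
    circ_supp_CM_eq_0[OF CM_supp[OF assms(3)] assms(1)] assms
  by (simp add: bracket_parity CM_cochains sg_def)

context
  fixes lam
  assumes lam: "lam \<in> CM M W 1 1" and lam_odd: "parity 1 lam"
begin

lemma \<alpha>_cochain: "\<delta> + lam \<in> cochains (M \<uplus> W)"
  and \<alpha>_odd: "parity 1 (\<delta> + lam)"
  by (simp_all add: cochains_plus has_parity_plus \<delta>_cochain \<delta>_odd CM_cochains[OF lam] lam_odd)

lemma \<alpha>_length: "length vs \<noteq> 2 \<Longrightarrow> (\<delta> + lam) vs = 0"
  using supp_length[OF CW_supp[OF \<delta>_CW], of vs] supp_length[OF CM_supp[OF lam], of vs] by simp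

lemma \<mu>_\<alpha>: "br \<mu> (\<delta> + lam) = br \<mu> lam"
  by (simp add: bracket_plus_right \<mu>_cochain \<delta>_cochain CM_cochains[OF lam] \<mu>_\<delta>)

lemma \<alpha>_CM:
  assumes "\<chi> \<in> CM M W k l" "parity q \<chi>"
  shows "br (\<delta> + lam) \<chi> \<in> CM M W k (Suc l)"
proof -
  have "br \<delta> \<chi> \<in> CM M W k (l + 1)"
    using bracket_CW_CM[of \<delta> 1] \<delta>_CW \<delta>_odd assms by (simp add: numeral_2_eq_2)
  moreover have "br lam \<chi> \<in> CM M W k (1 + l)"
    using bracket_CM[OF lam lam_odd assms] by simp
  ultimately show ?thesis
    by (simp add: bracket_plus_left \<delta>_cochain CM_cochains[OF lam] CM_cochains[OF assms(1)] CM_plus)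
qed

text \<open>The only part with values in \<open>W\<close> is [\<delta>, \<delta>] = 0; what remains
  is 2 [\<delta>, \<lambda>] + [\<lambda>, \<lambda>].\<close>

lemma \<alpha>_\<alpha>_CM: "br (\<delta> + lam) (\<delta> + lam) \<in> CM M W 1 2"
proof -
  have "br \<delta> lam \<in> CM M W 1 2"
    using bracket_CW_CM[of \<delta> 1 1 lam] \<delta>_CW \<delta>_odd lam lam_odd by (simp add: numeral_2_eq_2)
  moreover from this have "br lam \<delta> \<in> CM M W 1 2"
    by (simp add: bracket_odd_commute \<delta>_cochain \<delta>_odd lam_odd CM_cochains[OF lam])
  moreover have "br lam lam \<in> CM M W 1 2"
    using bracket_CM[OF lam lam_odd lam lam_odd, of 1] by (simp add: numeral_2_eq_2)
  moreover have "br (\<delta> + lam) (\<delta> + lam) = br \<delta> lam + (br lam \<delta> + br lam lam)"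
    by (simp add: bracket_plus_left bracket_plus_right \<delta>_cochain CM_cochains[OF lam] cochains_plus \<delta>_\<delta>)
  ultimately show ?thesis by (simp add: CM_plus)
qed

lemma \<alpha>_\<alpha>_even: "parity 0 (br (\<delta> + lam) (\<delta> + lam))"
  using has_parity_bracket[OF \<alpha>_cochain \<alpha>_odd \<alpha>_cochain \<alpha>_odd] by simp

lemma \<alpha>_\<alpha>_\<alpha>: "br (\<delta> + lam) (br (\<delta> + lam) (\<delta> + lam)) = 0"
  by (rule bracket_bracket_odd[OF \<alpha>_cochain \<alpha>_odd \<alpha>_length])

text \<open>Since \<open>[\<mu>, \<alpha>] = 0 = [\<mu>, \<mu>]\<close>, the square of \<open>\<mu> + \<alpha>\<close> is that of \<open>\<alpha>\<close>, so the
  Bianchi identities for \<open>\<mu> + \<alpha>\<close> and \<open>\<alpha>\<close> differ by \<open>[\<mu>, [\<alpha>, \<alpha>]]\<close>.\<close>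

lemma \<mu>_\<alpha>_\<alpha>:
  assumes "br \<mu> lam = 0"
  shows "br \<mu> (br (\<delta> + lam) (\<delta> + lam)) = 0"
proof -
  let ?\<alpha> = "\<delta> + lam"
  have c: "\<mu> + ?\<alpha> \<in> cochains (M \<uplus> W)" and o: "parity 1 (\<mu> + ?\<alpha>)"
    by (rule cochains_plus[OF \<mu>_cochain \<alpha>_cochain] has_parity_plus[OF \<mu>_odd \<alpha>_odd])+
  have l: "length vs \<noteq> 2 \<Longrightarrow> (\<mu> + ?\<alpha>) vs = 0" for vs
    using supp_length[OF CM_supp[OF \<mu>_CM], of vs] \<alpha>_length[of vs] by simp
  have "br \<mu> ?\<alpha> = 0" using assms by (simp add: \<mu>_\<alpha>)
  moreover from this have "br ?\<alpha> \<mu> = 0"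
    by (simp add: bracket_odd_commute[OF \<alpha>_cochain \<alpha>_odd \<mu>_cochain \<mu>_odd])
  ultimately have "br (\<mu> + ?\<alpha>) (\<mu> + ?\<alpha>) = br ?\<alpha> ?\<alpha>"
    by (simp add: bracket_plus_left bracket_plus_right \<mu>_cochain \<alpha>_cochain c \<mu>_\<mu>)
  moreover have "br (\<mu> + ?\<alpha>) (br (\<mu> + ?\<alpha>) (\<mu> + ?\<alpha>)) = 0"
    by (rule bracket_bracket_odd[OF c o l])
  ultimately have "br (\<mu> + ?\<alpha>) (br ?\<alpha> ?\<alpha>) = 0" by simp
  then show ?thesis
    by (simp add: bracket_plus_left[OF \<mu>_cochain \<alpha>_cochain CM_cochains[OF \<alpha>_\<alpha>_CM]] \<alpha>_\<alpha>_\<alpha>)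
qed

lemma is_extension_iff:
  "is_extension M W \<delta> \<mu> lam \<psi> \<longleftrightarrow>
     \<psi> \<in> CM M W 0 2 \<and> parity 1 \<psi> \<and> br \<mu> lam = 0 \<and>
     br (\<delta> + lam) (\<delta> + lam) + (br \<mu> \<psi> + br \<mu> \<psi>) = 0 \<and> br (\<delta> + lam) \<psi> = 0"
proof (cases "\<psi> \<in> CM M W 0 2 \<and> parity 1 \<psi>")
  case True
  then have \<psi>: "\<psi> \<in> CM M W 0 2" "parity 1 \<psi>" "\<psi> \<in> cochains (M \<uplus> W)"
    by (auto dest: CM_cochains)
  let ?\<alpha> = "\<delta> + lam"
  \<comment> \<open>Brackets of odd cochains are symmetric, so every mixed term occurs twice. The
    three parts have types (2,1), (1,2) and (0,3).\<close>
  let ?X = "br \<mu> lam + br \<mu> lam"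
  let ?Y = "br ?\<alpha> ?\<alpha> + (br \<mu> \<psi> + br \<mu> \<psi>)"
  let ?Z = "br ?\<alpha> \<psi> + br ?\<alpha> \<psi>"
  let ?d = "\<mu> + (?\<alpha> + \<psi>)"
  note cs = \<mu>_cochain \<alpha>_cochain \<psi>(3) \<alpha>_cochain[THEN cochains_plus, OF \<psi>(3)]
  have d: "?d \<in> cochains (M \<uplus> W)" "parity 1 ?d"
    using cochains_plus[OF cs(1,4)] has_parity_plus[OF \<mu>_odd has_parity_plus[OF \<alpha>_odd \<psi>(2)]] .
  have "br ?d ?d = ?X + ?Y + ?Z"
    using bracket_odd_commute[OF \<alpha>_cochain \<alpha>_odd \<mu>_cochain \<mu>_odd]
      bracket_odd_commute[OF \<psi>(3,2) \<mu>_cochain \<mu>_odd]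
      bracket_odd_commute[OF \<psi>(3,2) \<alpha>_cochain \<alpha>_odd]
    by (simp add: bracket_plus_left bracket_plus_right cs d(1) \<mu>_\<mu> bracket_\<psi>_\<psi>[OF \<psi>(1,2) \<psi>(1,2)]
        \<mu>_\<alpha>)
  moreover have "?X + ?Y + ?Z = 0 \<longleftrightarrow> ?X = 0 \<and> ?Y = 0 \<and> ?Z = 0"
  proof
    have "br \<mu> lam \<in> CM M W 2 1" "br \<mu> \<psi> \<in> CM M W 1 2" "br ?\<alpha> \<psi> \<in> CM M W 0 3"
      using bracket_CM[OF \<mu>_CM \<mu>_odd lam lam_odd, of 2] bracket_CM[OF \<mu>_CM \<mu>_odd \<psi>(1,2), of 1]
        \<alpha>_CM[OF \<psi>(1,2)] by (simp_all add: numeral_eq_Suc)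
    then have XYZ: "?X \<in> CM M W 2 1" "?Y \<in> CM M W 1 2" "?Z \<in> CM M W 0 3"
      by (blast intro: CM_plus \<alpha>_\<alpha>_CM)+
    assume sum: "?X + ?Y + ?Z = 0"
    \<comment> \<open>For a given (i, j) at least two of the three parts vanish by their type, and
      then the sum kills the third.\<close>
    have "?X vs = 0 \<and> ?Y vs = 0" if "vs \<in> pure_tensors i j" for vs i j
    proof -
      have "?X vs + ?Y vs + ?Z vs = 0" using fun_cong[OF sum, of vs] by simp
      then show ?thesis
        using supp_vanish[OF CM_supp[OF XYZ(1)] that] supp_vanish[OF CM_supp[OF XYZ(2)] that]
          supp_vanish[OF CM_supp[OF XYZ(3)] that]
        by (cases "(i, j) = (2, 1)"; cases "(i, j) = (1, 2)") auto
    qed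
    then have "?X = 0" "?Y = 0"
      using cochains_eq_0I[OF CM_cochains[OF XYZ(1)]] cochains_eq_0I[OF CM_cochains[OF XYZ(2)]]
      by blast+
    then show "?X = 0 \<and> ?Y = 0 \<and> ?Z = 0" using sum by simp
  qed simp
  moreover have "?X = 0 \<longleftrightarrow> br \<mu> lam = 0" "?Z = 0 \<longleftrightarrow> br ?\<alpha> \<psi> = 0"
    by (auto dest: double_fun_eq_zero)
  moreover have "is_extension M W \<delta> \<mu> lam \<psi> \<longleftrightarrow> br ?d ?d = 0"
    using \<psi> lam lam_odd d by (simp add: is_extension_def codifferential_def ac_simps)
  ultimately show ?thesis using \<psi> by simp
qed (auto simp: is_extension_def)

end

end

section \<open>The action of restricted equivalences\<close>

text \<open>Closure under differences makes \<open>B\<close> a subgroup, so translation by an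
  element of \<open>B\<close> permutes \<open>B\<close>.\<close>

lemma subquot_class_eq_iff:
  fixes A B :: "'a::ab_group_add set"
  assumes B: "0 \<in> B" "\<And>b c. b \<in> B \<Longrightarrow> c \<in> B \<Longrightarrow> b - c \<in> B"
    and "x \<in> A" "y \<in> A"
  shows "subquot A B `` {x} = subquot A B `` {y} \<longleftrightarrow> (\<exists>b\<in>B. y = x + b)"
proof
  assume "subquot A B `` {x} = subquot A B `` {y}"
  moreover have "y \<in> subquot A B `` {y}"
    using assms by (auto simp: subquot_def intro: bexI[of _ 0])
  ultimately show "\<exists>b\<in>B. y = x + b" by (auto simp: subquot_def)
next
  assume "\<exists>b\<in>B. y = x + b"
  then obtain b where b: "b \<in> B" "y = x + b" by blast
  have "(\<exists>c\<in>B. z = x + c) \<longleftrightarrow> (\<exists>c\<in>B. z = y + c)" for z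
  proof
    assume "\<exists>c\<in>B. z = x + c"
    then obtain c where "c \<in> B" "z = x + c" by blast
    then show "\<exists>c\<in>B. z = y + c" using b B(2) by (intro bexI[of _ "c - b"]) simp_all
  next
    assume "\<exists>c\<in>B. z = y + c"
    then obtain c where c: "c \<in> B" "z = y + c" by blast
    have "c - (0 - b) \<in> B" using B b c by blast
    then show "\<exists>c\<in>B. z = x + c" using b c by (intro bexI[of _ "c - (0 - b)"]) (simp_all add: algebra_simps)
  qed
  then show "subquot A B `` {x} = subquot A B `` {y}"
    using assms(3,4) by (auto simp: subquot_def)
qed

context graded_pair
begin

lemma supp_0_1_snd_0:
  assumes "\<beta> \<in> supp 0 1" "snd x = 0"
  shows "\<beta> [x] = 0"
proof -
  obtain m where "x = (m, 0)" using assms(2) by (cases x) auto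
  then have "[x] \<in> pure_tensors 1 0" by (auto simp: pure_tensors_Cons pure_tensors_Nil)
  then show ?thesis using supp_vanish[OF assms(1)] by simp
qed

lemma cochains_add_1: "\<phi> \<in> cochains (M \<uplus> W) \<Longrightarrow> \<phi> [x + y] = \<phi> [x] + \<phi> [y]"
  using cochains_add[of \<phi> "[]"] by simp

lemma supp_0_2_snd_0:
  assumes \<psi>: "\<psi> \<in> supp 0 2" and x: "snd x = 0"
  shows "\<psi> [x, y] = 0" "\<psi> [y, x] = 0"
proof -
  obtain m where x: "x = (m, 0)" using x by (cases x) auto
  obtain m' w where "y = (m', w)" by (cases y)
  then have y: "y = (m', 0) + (0, w)" by simp
  have "[x, (m', 0)] \<in> pure_tensors 2 0" "[x, (0, w)] \<in> pure_tensors 1 1"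
    "[(m', 0), x] \<in> pure_tensors 2 0" "[(0, w), x] \<in> pure_tensors 1 1"
    by (simp_all add: pure_tensors_Cons pure_tensors_Nil x numeral_2_eq_2)
  then have "\<psi> [x, (m', 0)] = 0" "\<psi> [x, (0, w)] = 0" "\<psi> [(m', 0), x] = 0" "\<psi> [(0, w), x] = 0"
    using supp_vanish[OF \<psi>] by (metis Pair_inject zero_neq_numeral zero_neq_one)+
  then show "\<psi> [x, y] = 0" "\<psi> [y, x] = 0"
    unfolding y cochains_add_2[OF suppD[OF \<psi>]] by simp_all
qed

lemma supp_1_1_snd_0:
  assumes "\<phi> \<in> supp 1 1" "snd x = 0" "snd y = 0"
  shows "\<phi> [x, y] = 0"
proof -
  obtain m n where "x = (m, 0)" "y = (n, 0)" using assms(2,3) by (cases x; cases y) auto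
  then have "[x, y] \<in> pure_tensors 2 0" by (simp add: pure_tensors_Cons pure_tensors_Nil numeral_2_eq_2)
  then show ?thesis using supp_vanish[OF assms(1)] by simp
qed

section \<open>The group of restricted equivalences\<close>

lemma exp_map_eq:
  assumes "\<beta> \<in> CM M W 0 1"
  shows "exp_map \<beta> v = v + \<beta> [v]"
proof -
  obtain m w where v: "v = (m, w)" by (cases v)
  have "\<beta> [v] = \<beta> [(m, 0)] + \<beta> [(0, w)]"
    using cochains_add_1[OF CM_cochains[OF assms], of "(m, 0)" "(0, w)"] by (simp add: v)
  then have "\<beta> [v] = \<beta> [(0, w)]" using supp_0_1_snd_0[OF CM_supp[OF assms]] by simp
  then show ?thesis using CM_snd[OF assms] by (simp add: exp_map_def v prod_eq_iff)
qed

text \<open>The cross term vanishes: \<beta>' takes values in \<open>M\<close>, where \<beta> is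
  zero. So exponents add, and the group is commutative.\<close>

lemma exp_map_comp:
  assumes "\<beta> \<in> CM M W 0 1" "\<beta>' \<in> CM M W 0 1"
  shows "exp_map \<beta> (exp_map \<beta>' v) = exp_map (\<beta> + \<beta>') v"
proof -
  have "\<beta> [\<beta>' [v]] = 0"
    using supp_0_1_snd_0[OF CM_supp[OF assms(1)]] CM_snd[OF assms(2)] by simp
  then show ?thesis
    by (simp add: exp_map_eq[OF assms(1)] exp_map_eq[OF assms(2)] exp_map_eq[OF CM_plus[OF assms]]
        cochains_add_1[OF CM_cochains[OF assms(1)]] algebra_simps)
qed

lemma exp_map_0: "exp_map 0 v = v"
  by (simp add: exp_map_def split: prod.split)

lemma exp_map_inverse:
  assumes "\<beta> \<in> CM M W 0 1"
  shows "exp_map (- \<beta>) (exp_map \<beta> v) = v" "exp_map \<beta> (exp_map (- \<beta>) v) = v"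
  using exp_map_comp[OF CM_uminus[OF assms] assms] exp_map_comp[OF assms CM_uminus[OF assms]]
  by (simp_all add: exp_map_0)

lemma inv_exp_map: "\<beta> \<in> CM M W 0 1 \<Longrightarrow> inv (exp_map \<beta>) = exp_map (- \<beta>)"
  by (intro inv_equality) (simp_all add: exp_map_inverse)

lemma lin_exp_map:
  assumes "\<beta> \<in> CM M W 0 1"
  shows "lin (exp_map \<beta>)"
  using cochains_scale[OF CM_cochains[OF assms], of "[]"]
  by (auto simp: lin_iff exp_map_eq[OF assms] cochains_add_1[OF CM_cochains[OF assms]]
      vs.scale_right_distrib)

lemma exp_map_homog:
  assumes "\<beta> \<in> CM M W 0 1" "has_parity (M \<uplus> W) 0 \<beta>" "v \<in> homog (M \<uplus> W) p"
  shows "exp_map \<beta> v \<in> homog (M \<uplus> W) p"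
proof -
  have "\<beta> [v] \<in> homog (M \<uplus> W) (0 + sum_list [p])"
    using assms(2,3) unfolding has_parity_def by (metis list_all2_Cons list_all2_Nil)
  then show ?thesis using assms by (simp add: exp_map_eq homog_add)
qed

abbreviation B01 :: "(('m \<times> 'w) list \<Rightarrow> 'm \<times> 'w) set" where
  "B01 \<equiv> {\<beta> \<in> CM M W 0 1. has_parity (M \<uplus> W) 0 \<beta>}"

lemma pullback_exp_map_comp:
  assumes "\<beta> \<in> CM M W 0 1" "\<beta>' \<in> CM M W 0 1"
  shows "pullback (exp_map \<beta>') (pullback (exp_map \<beta>) d) = pullback (exp_map (\<beta> + \<beta>')) d"
  using assms
  by (simp add: pullback_def inv_exp_map CM_plus exp_map_comp CM_uminus comp_def add.commute)

text \<open>A restricted class is an orbit of the additive group \<open>B01\<close>, which is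
  permuted by translation by each of its elements.\<close>

lemma rest_class_eq_iff:
  "rest_class M W d = rest_class M W d' \<longleftrightarrow> (\<exists>\<beta>\<in>B01. d' = pullback (exp_map \<beta>) d)"
proof -
  have rc: "rest_class M W d = (\<lambda>\<beta>. pullback (exp_map \<beta>) d) ` B01" for d
    by (auto simp: rest_class_def G_rest_def)
  show ?thesis
  proof
    assume "rest_class M W d = rest_class M W d'"
    moreover have "pullback (exp_map 0) d' = d'"
      by (simp add: pullback_def inv_exp_map CM_0 exp_map_0 cong: map_cong)
    then have "d' \<in> rest_class M W d'"
      unfolding rc by (metis (mono_tags, lifting) CM_0 has_parity_0 imageI mem_Collect_eq)
    ultimately show "\<exists>\<beta>\<in>B01. d' = pullback (exp_map \<beta>) d" by (auto simp: rc)
  next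
    assume "\<exists>\<beta>\<in>B01. d' = pullback (exp_map \<beta>) d"
    then obtain \<beta> where \<beta>: "\<beta> \<in> B01" and d': "d' = pullback (exp_map \<beta>) d" by blast
    have "rest_class M W d' = (\<lambda>\<beta>'. pullback (exp_map \<beta>') d) ` (\<lambda>\<beta>'. \<beta> + \<beta>') ` B01"
      unfolding rc image_image using \<beta>
      by (intro image_cong) (simp_all add: d' pullback_exp_map_comp)
    also have "(\<lambda>\<beta>'. \<beta> + \<beta>') ` B01 = B01"
    proof
      show "(\<lambda>\<beta>'. \<beta> + \<beta>') ` B01 \<subseteq> B01" using \<beta> by (auto simp: CM_plus has_parity_plus)
      show "B01 \<subseteq> (\<lambda>\<beta>'. \<beta> + \<beta>') ` B01"
      proof
        fix \<gamma> assume "\<gamma> \<in> B01"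
        then show "\<gamma> \<in> (\<lambda>\<beta>'. \<beta> + \<beta>') ` B01"
          using \<beta> by (intro image_eqI[of _ _ "\<gamma> - \<beta>"]) (simp_all add: CM_diff has_parity_diff)
      qed
    qed
    finally show "rest_class M W d = rest_class M W d'" by (simp add: rc)
  qed
qed

end

section \<open>Explicit formula for the action on extensions\<close>

context extension_data
begin

text \<open>The part of the transformed structure that is quadratic in \<beta>. As an iterated
  bracket it inherits its type, its parity and its vanishing for [\<mu>, \<beta>] = 0 from general
  facts.\<close>

definition half_square :: "(('m \<times> 'w) list \<Rightarrow> 'm \<times> 'w) \<Rightarrow> ('m \<times> 'w) list \<Rightarrow> 'm \<times> 'w" where
  "half_square \<beta> = (\<lambda>vs. smult (M \<uplus> W) (1 / 2) (br (br \<mu> \<beta>) \<beta> vs))"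

text \<open>The values of \<mu> lie in \<open>M\<close>, where \<beta> is zero, so only the
  composite with \<beta> inside \<mu> remains; \<beta> is even, so no signs appear.\<close>

lemma bracket_\<mu>_\<beta>:
  assumes \<beta>: "\<beta> \<in> CM M W 0 1" "parity 0 \<beta>"
  shows "br \<mu> \<beta> \<in> CM M W 1 1" "parity 1 (br \<mu> \<beta>)"
    and "br \<mu> \<beta> [a, b] = \<mu> [\<beta> [a], b] + \<mu> [a, \<beta> [b]]"
proof -
  note c = CM_cochains[OF \<beta>(1)]
  show "br \<mu> \<beta> \<in> CM M W 1 1"
    using bracket_CM[OF \<mu>_CM \<mu>_odd \<beta>, of 1] by simp
  show "parity 1 (br \<mu> \<beta>)"
    using has_parity_bracket[OF \<mu>_cochain \<mu>_odd c \<beta>(2)] by simp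
  have "\<And>vs. length vs \<noteq> 1 \<Longrightarrow> \<beta> vs = 0" using supp_length[OF CM_supp[OF \<beta>(1)]] by simp
  from circ_2_1[OF \<mu>_cochain this]
  show "br \<mu> \<beta> [a, b] = \<mu> [\<beta> [a], b] + \<mu> [a, \<beta> [b]]"
    using circ_supp_CM_eq_0[OF CM_supp[OF \<beta>(1)] \<mu>_CM]
    by (simp add: bracket_parity[OF \<mu>_cochain \<mu>_odd c \<beta>(2)])
qed

lemma half_square:
  assumes \<beta>: "\<beta> \<in> CM M W 0 1" "parity 0 \<beta>"
  shows "half_square \<beta> \<in> CM M W 0 2" "parity 1 (half_square \<beta>)"
    and "half_square \<beta> [a, b] = \<mu> [\<beta> [a], \<beta> [b]]"
    and "br \<mu> \<beta> = 0 \<Longrightarrow> half_square \<beta> = 0"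
proof -
  note c = CM_cochains[OF \<beta>(1)]
  note \<nu> = bracket_\<mu>_\<beta>(1,2)[OF \<beta>]
  note \<nu>_eq = bracket_\<mu>_\<beta>(3)[OF \<beta>]
  note \<nu>c = CM_cochains[OF \<nu>(1)]
  show "half_square \<beta> \<in> CM M W 0 2"
    unfolding half_square_def
    using CM_smult[OF bracket_CM[OF \<nu> \<beta>, of 0]] by (simp add: numeral_2_eq_2)
  show "parity 1 (half_square \<beta>)"
    unfolding half_square_def
    using has_parity_smult[OF has_parity_bracket[OF \<nu>c \<nu>(2) c \<beta>(2)]] by simp
  have l: "\<And>vs. length vs \<noteq> 1 \<Longrightarrow> \<beta> vs = 0" using supp_length[OF CM_supp[OF \<beta>(1)]] by simp
  have \<beta>\<beta>: "\<beta> [\<beta> [x]] = 0" for x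
    using supp_0_1_snd_0[OF CM_supp[OF \<beta>(1)]] CM_snd[OF \<beta>(1)] by simp
  have br: "br (br \<mu> \<beta>) \<beta> = circ (M \<uplus> W) 0 (br \<mu> \<beta>) \<beta>"
    using circ_supp_CM_eq_0[OF CM_supp[OF \<beta>(1)] \<nu>(1)]
    by (simp add: bracket_parity[OF \<nu>c \<nu>(2) c \<beta>(2)])
  \<comment> \<open>Inserting \<beta> into [\<mu>, \<beta>] gives four terms: those applying \<beta>
    twice to one argument vanish, the other two coincide.\<close>
  have "br (br \<mu> \<beta>) \<beta> [a, b] = \<mu> [\<beta> [a], \<beta> [b]] + \<mu> [\<beta> [a], \<beta> [b]]"
    using cochains_zero[OF \<mu>_cochain, of "[]"] cochains_zero[OF \<mu>_cochain, of "[x]" "[]" for x]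
    by (simp add: br circ_2_1[OF \<nu>c l] \<nu>_eq \<beta>\<beta>)
  then show "half_square \<beta> [a, b] = \<mu> [\<beta> [a], \<beta> [b]]"
    by (simp add: half_square_def)
  show "half_square \<beta> = 0" if "br \<mu> \<beta> = 0"
  proof -
    have "br (br \<mu> \<beta>) \<beta> = 0" by (subst br) (simp add: that)
    then show ?thesis by (simp add: half_square_def fun_eq_iff)
  qed
qed

text \<open>The structure is expanded on arguments \<open>v + \<beta> [v]\<close>, and the inverse
  subtracts \<beta> of the value. One \<beta> inside \<mu> gives [\<mu>, \<beta>], two give
  \<open>half_square \<beta>\<close>; one \<beta> inside \<lambda>, together with minus \<beta>
  after \<delta>, gives [\<delta> + \<lambda>, \<beta>]. Every other term puts an element of
  \<open>M\<close> into a slot for \<open>W\<close>.\<close>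

lemma pullback_exp_map:
  assumes \<beta>: "\<beta> \<in> CM M W 0 1" "parity 0 \<beta>"
    and lam: "lam \<in> CM M W 1 1" "parity 1 lam" and \<psi>: "\<psi> \<in> CM M W 0 2"
  shows "pullback (exp_map \<beta>) (\<delta> + \<mu> + lam + \<psi>) =
    \<delta> + \<mu> + (lam + br \<mu> \<beta>) + (\<psi> + (br (\<delta> + lam) \<beta> + half_square \<beta>))"
    (is "pullback _ ?d = ?d'")
proof
  fix vs
  note c = CM_cochains[OF \<beta>(1)]
  note \<alpha>c = \<alpha>_cochain[OF lam] and \<alpha>o = \<alpha>_odd[OF lam]
  have b1: "\<beta> [x] = 0" if "snd x = 0" for x
    using supp_0_1_snd_0[OF CM_supp[OF \<beta>(1)]] that .
  have snd: "snd (\<beta> vs) = 0" "snd (\<mu> vs) = 0" "snd (lam vs) = 0" "snd (\<psi> vs) = 0" for vs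
    using \<beta> \<mu>_CM lam \<psi> by (auto dest: CM_snd)
  have pb: "pullback (exp_map \<beta>) ?d vs = ?d (map (exp_map \<beta>) vs) - \<beta> [?d (map (exp_map \<beta>) vs)]"
    by (simp add: pullback_def inv_exp_map[OF \<beta>(1)] exp_map_eq[OF CM_uminus[OF \<beta>(1)]])
  show "pullback (exp_map \<beta>) ?d vs = ?d' vs"
  proof (cases "length vs = 2")
    case True
    then obtain a b where vs: "vs = [a, b]" by (rule length_2E)
    have l: "\<And>vs. length vs \<noteq> 1 \<Longrightarrow> \<beta> vs = 0" using supp_length[OF CM_supp[OF \<beta>(1)]] by simp
    note add2 = cochains_add_2[OF \<delta>_cochain] cochains_add_2[OF \<mu>_cochain]
      cochains_add_2[OF CM_cochains[OF lam(1)]] cochains_add_2[OF CM_cochains[OF \<psi>]]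
    note zero2 = supp_0_2_snd_0[OF CW_supp[OF \<delta>_CW] snd(1)]
      supp_0_2_snd_0[OF CM_supp[OF \<psi>] snd(1)] supp_1_1_snd_0[OF CM_supp[OF lam(1)] snd(1) snd(1)]
    have br: "br (\<delta> + lam) \<beta> [a, b] = lam [\<beta> [a], b] + lam [a, \<beta> [b]] - \<beta> [\<delta> [a, b]]"
      using circ_2_1[where \<chi> = \<beta>, OF \<alpha>c l] circ_1_2[where \<chi> = "\<delta> + lam", OF c \<alpha>_length[OF lam]]
      by (simp add: bracket_parity[OF \<alpha>c \<alpha>o c \<beta>(2)] zero2 cochains_add_1[OF c] b1 snd)
    show ?thesis
      unfolding pb
      by (simp add: vs br exp_map_eq[OF \<beta>(1)] add2 zero2 bracket_\<mu>_\<beta>(3)[OF \<beta>] half_square(3)[OF \<beta>]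
          cochains_add_1[OF c] b1 snd algebra_simps)
  next
    case False
    have "br (\<delta> + lam) \<beta> \<in> CM M W 0 2"
      using \<alpha>_CM[OF lam \<beta>] by (simp add: numeral_2_eq_2)
    then show ?thesis
      using False supp_length[OF CW_supp[OF \<delta>_CW]] supp_length[OF CM_supp[OF \<mu>_CM]]
        supp_length[OF CM_supp[OF lam(1)]] supp_length[OF CM_supp[OF \<psi>]]
        supp_length[OF CM_supp[OF bracket_\<mu>_\<beta>(1)[OF \<beta>]]]
        supp_length[OF CM_supp[OF half_square(1)[OF \<beta>]]] supp_length[OF CM_supp]
      by (simp add: pb b1)
  qed
qed

text \<open>All equations for the new pair hold at once, since by \<open>pullback_exp_map\<close>
  the new structure is a conjugate of a codifferential by a graded automorphism.\<close>

lemma is_extension_pullback: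
  assumes ext: "is_extension M W \<delta> \<mu> lam \<psi>" and \<beta>: "\<beta> \<in> CM M W 0 1" "parity 0 \<beta>"
  shows "is_extension M W \<delta> \<mu> (lam + br \<mu> \<beta>) (\<psi> + (br (\<delta> + lam) \<beta> + half_square \<beta>))"
proof -
  have lam: "lam \<in> CM M W 1 1" "parity 1 lam" and \<psi>: "\<psi> \<in> CM M W 0 2" "parity 1 \<psi>"
    and d: "codifferential (M \<uplus> W) (\<delta> + \<mu> + lam + \<psi>)"
    using ext by (auto simp: is_extension_def)
  have "br (\<delta> + lam) \<beta> \<in> CM M W 0 2" "parity 1 (br (\<delta> + lam) \<beta>)"
    using \<alpha>_CM[OF lam \<beta>] has_parity_bracket[OF \<alpha>_cochain[OF lam] \<alpha>_odd[OF lam] CM_cochains[OF \<beta>(1)] \<beta>(2)]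
    by (simp_all add: numeral_2_eq_2)
  moreover have "codifferential (M \<uplus> W) (pullback (exp_map \<beta>) (\<delta> + \<mu> + lam + \<psi>))"
    using CM_uminus[OF \<beta>(1)] has_parity_uminus[OF \<beta>(2)] \<beta>
    by (intro codifferential_pullback[OF d, of "exp_map (- \<beta>)"])
      (simp_all add: exp_map_inverse lin_exp_map exp_map_homog)
  ultimately show ?thesis
    using bracket_\<mu>_\<beta>(1,2)[OF \<beta>] half_square(1,2)[OF \<beta>] lam \<psi>
    by (simp add: is_extension_def pullback_exp_map[OF \<beta> lam \<psi>(1)] CM_plus has_parity_plus)
qed

text \<open>Cochains of different types meet only in 0.\<close>

lemma extension_components:
  assumes "lam \<in> CM M W 1 1" "\<psi> \<in> CM M W 0 2" "lam' \<in> CM M W 1 1" "\<psi>' \<in> CM M W 0 2"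
    and eq: "\<delta> + \<mu> + lam + \<psi> = \<delta> + \<mu> + lam' + \<psi>'"
  shows "lam = lam'" "\<psi> = \<psi>'"
proof -
  have "lam - lam' = \<psi>' - \<psi>" using eq by (simp add: algebra_simps)
  moreover have "lam - lam' \<in> CM M W 1 1" "\<psi>' - \<psi> \<in> CM M W 0 2" using assms by (simp_all add: CM_diff)
  ultimately have "lam - lam' = 0" using CM_Int_eq_0[of "lam - lam'" 1 1 0 2] by simp
  then show "lam = lam'" "\<psi> = \<psi>'" using eq by simp_all
qed

lemma rest_class_extension_eq_iff:
  assumes "is_extension M W \<delta> \<mu> lam \<psi>" "is_extension M W \<delta> \<mu> lam' \<psi>'"
  shows "rest_class M W (\<delta> + \<mu> + lam + \<psi>) = rest_class M W (\<delta> + \<mu> + lam' + \<psi>') \<longleftrightarrow>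
    (\<exists>\<beta>\<in>B01. lam' = lam + br \<mu> \<beta> \<and> \<psi>' = \<psi> + (br (\<delta> + lam) \<beta> + half_square \<beta>))"
proof -
  have "\<delta> + \<mu> + lam' + \<psi>' = pullback (exp_map \<beta>) (\<delta> + \<mu> + lam + \<psi>) \<longleftrightarrow>
    lam' = lam + br \<mu> \<beta> \<and> \<psi>' = \<psi> + (br (\<delta> + lam) \<beta> + half_square \<beta>)" if "\<beta> \<in> B01" for \<beta>
  proof -
    have \<beta>: "\<beta> \<in> CM M W 0 1" "parity 0 \<beta>" using that by auto
    have pb: "pullback (exp_map \<beta>) (\<delta> + \<mu> + lam + \<psi>) =
      \<delta> + \<mu> + (lam + br \<mu> \<beta>) + (\<psi> + (br (\<delta> + lam) \<beta> + half_square \<beta>))"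
      using assms(1) by (intro pullback_exp_map[OF \<beta>]) (auto simp: is_extension_def)
    show ?thesis
      unfolding pb
      using extension_components[of lam' \<psi>' "lam + br \<mu> \<beta>" "\<psi> + (br (\<delta> + lam) \<beta> + half_square \<beta>)"]
        is_extension_pullback[OF assms(1) \<beta>] assms(2) unfolding is_extension_def by blast
  qed
  then show ?thesis unfolding rest_class_eq_iff by (rule bex_cong[OF refl])
qed

end

section \<open>Cohomology classes\<close>

text \<open>Both \<open>B\<close> and \<open>C\<close> are quotients of \<open>A\<close> by the same
  equivalence relation. In the application \<open>A\<close> consists of odd \<tau>, \<open>B\<close>
  of cohomology classes and \<open>C\<close> of orbits.\<close>

lemma bij_betw_factor:
  assumes f: "f ` A = B" and g: "g ` A = C"
    and iff: "\<And>x y. x \<in> A \<Longrightarrow> y \<in> A \<Longrightarrow> f x = f y \<longleftrightarrow> g x = g y"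
  obtains F where "bij_betw F B C" "\<And>x. x \<in> A \<Longrightarrow> F (f x) = g x"
proof -
  define F where "F b = g (SOME x. x \<in> A \<and> f x = b)" for b
  have F: "F (f x) = g x" if "x \<in> A" for x
  proof -
    have "(SOME y. y \<in> A \<and> f y = f x) \<in> A \<and> f (SOME y. y \<in> A \<and> f y = f x) = f x"
      by (rule someI[of _ x]) (simp add: that)
    then show ?thesis using iff that by (auto simp: F_def)
  qed
  have "bij_betw F B C"
    unfolding bij_betw_def
  proof
    show "inj_on F B" using iff by (auto simp: inj_on_def F simp flip: f)
    show "F ` B = C" by (auto simp: F image_image simp flip: f g)
  qed
  then show ?thesis using F that by blast
qed

section \<open>Classes of \<lambda> and the condition for extending them\<close>

context extension_data
begin

text \<open>Bracketing with \<mu> shifts parity by one, so an odd value comes entirely from the even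
  part of \<beta>.\<close>

lemma even_part_\<mu>:
  assumes "\<beta> \<in> CM M W 0 1" "parity 1 (br \<mu> \<beta>)"
  obtains \<beta>' where "\<beta>' \<in> B01" "br \<mu> \<beta>' = br \<mu> \<beta>"
proof
  note c = CM_cochains[OF assms(1)]
  show "parity_part (M \<uplus> W) 0 \<beta> \<in> B01"
    using CM_parity_part[OF assms(1)] has_parity_parity_part[OF c] by simp
  \<comment> \<open>\<open>bracket_cochains\<close> concerns homogeneous arguments, so \<beta> is
    split first.\<close>
  have "br \<mu> \<beta> \<in> cochains (M \<uplus> W)"
  proof -
    have "br \<mu> \<beta> = br \<mu> (parity_part (M \<uplus> W) 0 \<beta>) + br \<mu> (parity_part (M \<uplus> W) 1 \<beta>)"
      by (simp add: bracket_plus_right[symmetric] \<mu>_cochain parity_part_cochains[OF c] parity_part_sum)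
    then show ?thesis
      by (simp add: cochains_plus bracket_cochains[OF \<mu>_cochain \<mu>_odd parity_part_cochains[OF c]
            has_parity_parity_part[OF c]])
  qed
  then show "br \<mu> (parity_part (M \<uplus> W) 0 \<beta>) = br \<mu> \<beta>"
    using assms(2) by (simp add: bracket_parity_part[OF \<mu>_cochain \<mu>_odd c] parity_part_parity)
qed

text \<open>Coboundaries allow primitives of any parity, restricted equivalences only even ones;
  \<open>even_part_\<mu>\<close> reconciles the two.\<close>

lemma Hmu_class_11_eq_iff:
  assumes lam: "lam \<in> cocycles M W \<mu> 1 1" "parity 1 lam"
    and lam': "lam' \<in> cocycles M W \<mu> 1 1" "parity 1 lam'"
  shows "Hmu_class M W \<mu> 1 1 lam = Hmu_class M W \<mu> 1 1 lam' \<longleftrightarrow> (\<exists>\<beta>\<in>B01. lam' = lam + br \<mu> \<beta>)"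
proof -
  have B: "coboundaries M W \<mu> 1 1 = br \<mu> ` CM M W 0 1" by (simp add: coboundaries_def)
  have "Hmu_class M W \<mu> 1 1 lam = Hmu_class M W \<mu> 1 1 lam' \<longleftrightarrow>
      (\<exists>b\<in>br \<mu> ` CM M W 0 1. lam' = lam + b)"
    unfolding Hmu_class_def B
  proof (rule subquot_class_eq_iff[OF _ _ lam(1) lam'(1)])
    show "0 \<in> br \<mu> ` CM M W 0 1"
      by (rule image_eqI[of _ _ 0]) (simp_all add: CM_0 bracket_0_right \<mu>_cochain)
    fix b c assume "b \<in> br \<mu> ` CM M W 0 1" "c \<in> br \<mu> ` CM M W 0 1"
    then obtain \<beta> \<gamma> where "b = br \<mu> \<beta>" "c = br \<mu> \<gamma>" and \<beta>: "\<beta> \<in> CM M W 0 1" "\<gamma> \<in> CM M W 0 1"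
      by blast
    then have "b - c = br \<mu> (\<beta> - \<gamma>)"
      by (simp add: bracket_diff_right \<mu>_cochain CM_cochains[OF \<beta>(1)] CM_cochains[OF \<beta>(2)])
    then show "b - c \<in> br \<mu> ` CM M W 0 1" using CM_diff[OF \<beta>] by blast
  qed
  also have "\<dots> \<longleftrightarrow> (\<exists>\<beta>\<in>B01. lam' = lam + br \<mu> \<beta>)"
  proof
    assume "\<exists>b\<in>br \<mu> ` CM M W 0 1. lam' = lam + b"
    then obtain \<beta> where \<beta>: "\<beta> \<in> CM M W 0 1" "lam' = lam + br \<mu> \<beta>" by blast
    then have "br \<mu> \<beta> = lam' - lam" by simp
    then have "parity 1 (br \<mu> \<beta>)" using lam lam' by (simp add: has_parity_diff)
    with \<beta>(1) obtain \<beta>' where "\<beta>' \<in> B01" "br \<mu> \<beta>' = br \<mu> \<beta>" by (rule even_part_\<mu>)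
    then show "\<exists>\<beta>\<in>B01. lam' = lam + br \<mu> \<beta>" using \<beta>(2) by auto
  qed blast
  finally show ?thesis .
qed

text \<open>The condition yields \<chi> with [\<alpha>, \<alpha>] + [\<mu>, \<chi>] = 0 and
  [\<alpha>, \<chi>] = 0; an extension satisfies these equations with 2 \<psi> in place of \<chi>,
  where \<psi> must be odd.\<close>

lemma MC_condition_iff:
  assumes "lam \<in> cocycles M W \<mu> 1 1" and lam_odd: "parity 1 lam"
  shows "MC_condition M W \<delta> \<mu> lam \<longleftrightarrow> (\<exists>\<psi>. is_extension M W \<delta> \<mu> lam \<psi>)"
proof -
  have lam: "lam \<in> CM M W 1 1" "br \<mu> lam = 0" using assms by (auto simp: cocycles_def)
  let ?\<alpha> = "\<delta> + lam"
  note \<alpha>c = \<alpha>_cochain[OF lam(1) lam_odd] and \<alpha>o = \<alpha>_odd[OF lam(1) lam_odd]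
  note \<alpha>\<alpha> = \<alpha>_\<alpha>_CM[OF lam(1) lam_odd]
  let ?A = "{\<phi> \<in> CM M W 1 2. br \<mu> \<phi> = 0 \<and> br ?\<alpha> \<phi> = 0}"
  let ?K = "{\<psi> \<in> CM M W 0 2. br ?\<alpha> \<psi> = 0}"
  have "MC_condition M W \<delta> \<mu> lam \<longleftrightarrow> (\<exists>b\<in>br \<mu> ` ?K. 0 = br ?\<alpha> ?\<alpha> + b)"
    unfolding MC_condition_def Hmu_ker_class_def
  proof (rule subquot_class_eq_iff)
    show "0 \<in> br \<mu> ` ?K"
      by (rule image_eqI[of _ _ 0]) (simp_all add: CM_0 bracket_0_right \<mu>_cochain \<alpha>c)
    show "br ?\<alpha> ?\<alpha> \<in> ?A"
      using \<alpha>\<alpha> \<mu>_\<alpha>_\<alpha>[OF lam(1) lam_odd lam(2)] \<alpha>_\<alpha>_\<alpha>[OF lam(1) lam_odd] by simp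
    show "0 \<in> ?A" by (simp add: CM_0 bracket_0_right \<mu>_cochain \<alpha>c)
    fix b c assume "b \<in> br \<mu> ` ?K" "c \<in> br \<mu> ` ?K"
    then obtain \<psi> \<psi>' where b: "b = br \<mu> \<psi>" "c = br \<mu> \<psi>'" and \<psi>: "\<psi> \<in> ?K" "\<psi>' \<in> ?K" by blast
    note c = CM_cochains[of \<psi> 0 2] CM_cochains[of \<psi>' 0 2]
    have "b - c = br \<mu> (\<psi> - \<psi>')" using b \<psi> c by (simp add: bracket_diff_right \<mu>_cochain)
    moreover have "\<psi> - \<psi>' \<in> ?K" using \<psi> c by (simp add: CM_diff bracket_diff_right \<alpha>c)
    ultimately show "b - c \<in> br \<mu> ` ?K" by blast
  qed
  also have "\<dots> \<longleftrightarrow> (\<exists>\<psi>\<in>?K. br ?\<alpha> ?\<alpha> + br \<mu> \<psi> = 0)" by auto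
  also have "\<dots> \<longleftrightarrow> (\<exists>\<psi>. is_extension M W \<delta> \<mu> lam \<psi>)"
  proof
    assume "\<exists>\<psi>\<in>?K. br ?\<alpha> ?\<alpha> + br \<mu> \<psi> = 0"
    then obtain \<chi> where \<chi>: "\<chi> \<in> CM M W 0 2" "br ?\<alpha> \<chi> = 0" and eq: "br ?\<alpha> ?\<alpha> + br \<mu> \<chi> = 0"
      by blast
    note c = CM_cochains[OF \<chi>(1)]
    \<comment> \<open>To get \<psi> from \<chi>, the odd part is taken and then halved.\<close>
    define \<theta> where "\<theta> = parity_part (M \<uplus> W) 1 \<chi>"
    define \<psi> where "\<psi> = (\<lambda>vs. smult (M \<uplus> W) (1 / 2) (\<theta> vs))"
    have \<theta>: "\<theta> \<in> CM M W 0 2" "parity 1 \<theta>"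
      using CM_parity_part[OF \<chi>(1)] has_parity_parity_part[OF c] by (simp_all add: \<theta>_def)
    have \<psi>: "\<psi> \<in> CM M W 0 2" "parity 1 \<psi>"
      using CM_smult[OF \<theta>(1)] has_parity_smult[OF \<theta>(2)] by (simp_all add: \<psi>_def)
    have \<psi>\<psi>: "\<psi> + \<psi> = \<theta>"
      by (simp add: \<psi>_def fun_eq_iff flip: vs.scale_right_distrib)
    have "br \<mu> \<chi> = - br ?\<alpha> ?\<alpha>" using eq by (simp add: eq_neg_iff_add_eq_0 add.commute)
    \<comment> \<open>The odd part of \<chi> goes to the even part of [\<mu>, \<chi>], which is
      everything because [\<alpha>, \<alpha>] is even.\<close>
    then have "br \<mu> \<theta> = br \<mu> \<chi>"
      using bracket_parity_part[OF \<mu>_cochain \<mu>_odd c, of 1]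
        parity_part_parity[OF cochains_uminus[OF CM_cochains[OF \<alpha>\<alpha>]]
          has_parity_uminus[OF \<alpha>_\<alpha>_even[OF lam(1) lam_odd]], of 0]
      by (simp add: \<theta>_def)
    then have 1: "br ?\<alpha> ?\<alpha> + (br \<mu> \<psi> + br \<mu> \<psi>) = 0"
      using eq by (simp add: bracket_plus_right[symmetric] \<mu>_cochain CM_cochains[OF \<psi>(1)] \<psi>\<psi>)
    have "br ?\<alpha> \<theta> = 0"
      using bracket_parity_part[OF \<alpha>c \<alpha>o c, of 1] \<chi>(2) by (simp add: \<theta>_def)
    then have "br ?\<alpha> \<psi> + br ?\<alpha> \<psi> = 0"
      by (simp add: bracket_plus_right[symmetric] \<alpha>c CM_cochains[OF \<psi>(1)] \<psi>\<psi>)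
    then have "br ?\<alpha> \<psi> = 0" by (rule double_fun_eq_zero)
    then show "\<exists>\<psi>. is_extension M W \<delta> \<mu> lam \<psi>"
      using is_extension_iff[OF lam(1) lam_odd] \<psi> 1 lam(2) by blast
  next
    assume "\<exists>\<psi>. is_extension M W \<delta> \<mu> lam \<psi>"
    then obtain \<psi> where \<psi>: "\<psi> \<in> CM M W 0 2"
      and eq: "br ?\<alpha> ?\<alpha> + (br \<mu> \<psi> + br \<mu> \<psi>) = 0" "br ?\<alpha> \<psi> = 0"
      using is_extension_iff[OF lam(1) lam_odd] by blast
    note c = CM_cochains[OF \<psi>]
    show "\<exists>\<psi>\<in>?K. br ?\<alpha> ?\<alpha> + br \<mu> \<psi> = 0"
      using eq \<psi> c
      by (intro bexI[of _ "\<psi> + \<psi>"]) (simp_all add: bracket_plus_right \<mu>_cochain \<alpha>c CM_plus)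
  qed
  finally show ?thesis .
qed

lemma extension_cocycle:
  assumes "is_extension M W \<delta> \<mu> lam \<psi>"
  shows "lam \<in> cocycles M W \<mu> 1 1" "parity 1 lam"
proof -
  have "lam \<in> CM M W 1 1" "parity 1 lam" using assms by (auto simp: is_extension_def)
  then show "lam \<in> cocycles M W \<mu> 1 1" "parity 1 lam"
    using assms is_extension_iff[of lam \<psi>] by (auto simp: cocycles_def)
qed

text \<open>If some \<open>lam'\<close> in the class extends, the equivalence
  \<open>exp_map \<beta>\<close> with \<open>lam = lam' + br \<mu> \<beta>\<close> moves that
  extension to one over \<open>lam\<close>. The left side sees \<open>lam\<close> only through its
  class, so the condition does not depend on the representative.\<close>

lemma extension_class_iff_MC:
  assumes "lam \<in> cocycles M W \<mu> 1 1" "parity 1 lam"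
  shows "(\<exists>lam' \<psi>. is_extension M W \<delta> \<mu> lam' \<psi> \<and> Hmu_class M W \<mu> 1 1 lam' = Hmu_class M W \<mu> 1 1 lam)
    \<longleftrightarrow> MC_condition M W \<delta> \<mu> lam"
  unfolding MC_condition_iff[OF assms]
proof
  assume "\<exists>lam' \<psi>. is_extension M W \<delta> \<mu> lam' \<psi> \<and> Hmu_class M W \<mu> 1 1 lam' = Hmu_class M W \<mu> 1 1 lam"
  then obtain lam' \<psi> where ext: "is_extension M W \<delta> \<mu> lam' \<psi>"
    and "Hmu_class M W \<mu> 1 1 lam' = Hmu_class M W \<mu> 1 1 lam" by blast
  then obtain \<beta> where "\<beta> \<in> B01" "lam = lam' + br \<mu> \<beta>"
    using Hmu_class_11_eq_iff[OF extension_cocycle[OF ext] assms] by blast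
  then show "\<exists>\<psi>. is_extension M W \<delta> \<mu> lam \<psi>" using is_extension_pullback[OF ext] by blast
qed blast

text \<open>For k = 0 the only coboundary is 0, so classes of cocycles are singletons.\<close>

lemma Hmu_class_0:
  "Hmu_class M W \<mu> 0 l \<phi> = (if \<phi> \<in> cocycles M W \<mu> 0 l then {\<phi>} else {})"
  by (auto simp: Hmu_class_def subquot_def coboundaries_def)

lemma Hmu_0: "Hmu M W \<mu> 0 l = (\<lambda>\<phi>. {\<phi>}) ` cocycles M W \<mu> 0 l"
  by (auto simp: Hmu_def quotient_def Hmu_class_0[unfolded Hmu_class_def])

lemma cocycles_0: "0 \<in> cocycles M W \<mu> k l"
  by (simp add: cocycles_def CM_0 bracket_0_right \<mu>_cochain)

section \<open>Classification of \<psi> for a fixed \<lambda>\<close>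

context
  fixes lam \<psi>
  assumes ext: "is_extension M W \<delta> \<mu> lam \<psi>"
begin

abbreviation (input) "\<alpha> \<equiv> \<delta> + lam"

text \<open>Representatives of the kernel of the induced map on classes. Its odd elements are the
  admissible changes of \<psi>, by \<open>is_extension_add_iff\<close>.\<close>

definition K02 :: "(('m \<times> 'w) list \<Rightarrow> 'm \<times> 'w) set" where
  "K02 = {\<tau> \<in> CM M W 0 2. br \<mu> \<tau> = 0 \<and> br \<alpha> \<tau> = 0}"

lemma \<alpha>_facts: "\<alpha> \<in> cochains (M \<uplus> W)" "parity 1 \<alpha>"
  using ext \<alpha>_cochain[of lam] \<alpha>_odd[of lam] by (simp_all add: is_extension_def)

lemma Dbar_kernel_eq: "Dbar_kernel M W \<mu> \<alpha> 0 2 = (\<lambda>\<tau>. {\<tau>}) ` K02"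
proof -
  have "Dbar M W \<mu> \<alpha> 0 2 {\<tau>} = Hmu_class M W \<mu> 0 (2 + 1) 0 \<longleftrightarrow> br \<alpha> \<tau> = 0" for \<tau>
  proof -
    have "Dbar M W \<mu> \<alpha> 0 2 {\<tau>} = Hmu_class M W \<mu> 0 (2 + 1) (br \<alpha> \<tau>)" by (simp add: Dbar_def)
    \<comment> \<open>The class of 0 is \<open>{0}\<close>. A nonzero bracket has a different
      singleton as its class, or the empty set if it is no cocycle.\<close>
    then show ?thesis using cocycles_0[of 0 "2 + 1"] by (cases "br \<alpha> \<tau> = 0") (simp_all add: Hmu_class_0)
  qed
  then show ?thesis
    by (auto simp: Dbar_kernel_def Hmu_0 K02_def cocycles_def)
qed

lemma H02_class_eq:
  "H02_class M W \<mu> \<alpha> \<tau> =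
    (if \<tau> \<in> K02 then (\<lambda>\<tau>. {\<tau>}) ` {\<tau>' \<in> K02. \<exists>\<beta>\<in>cocycles M W \<mu> 0 1. \<tau>' = \<tau> + br \<alpha> \<beta>} else {})"
proof (cases "\<tau> \<in> K02")
  case True
  then have \<tau>: "\<tau> \<in> cocycles M W \<mu> 0 2" by (simp add: K02_def cocycles_def)
  let ?B = "Dbar M W \<mu> \<alpha> 0 1 ` Hmu M W \<mu> 0 1"
  have key: "(\<exists>b\<in>?B. {\<tau>'} = {\<tau>} + b) \<longleftrightarrow>
      (\<exists>\<beta>\<in>cocycles M W \<mu> 0 1. \<tau>' = \<tau> + br \<alpha> \<beta>)" if \<tau>': "\<tau>' \<in> K02" for \<tau>'
  proof -
    have "{\<tau>'} = {\<tau>} + Dbar M W \<mu> \<alpha> 0 1 {\<beta>} \<longleftrightarrow> \<tau>' = \<tau> + br \<alpha> \<beta>" for \<beta>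
    proof -
      \<comment> \<open>\<open>Dbar\<close> of \<open>{\<beta>}\<close> would be empty if
        [\<alpha>, \<beta>] were not a cocycle; here it is a difference of two elements of
        \<open>K02\<close>.\<close>
      have "br \<alpha> \<beta> \<in> cocycles M W \<mu> 0 2" if "\<tau>' = \<tau> + br \<alpha> \<beta>"
      proof -
        have "br \<alpha> \<beta> = \<tau>' - \<tau>" using that by simp
        then show ?thesis
          using True \<tau>' CM_cochains[of \<tau>' 0 2] CM_cochains[of \<tau> 0 2]
          by (simp add: K02_def cocycles_def CM_diff bracket_diff_right \<mu>_cochain)
      qed
      then show ?thesis
        by (auto simp: Dbar_def Hmu_class_0 set_plus_def numeral_2_eq_2)
    qed
    then show ?thesis by (simp add: Hmu_0)
  qed
  have "H02_class M W \<mu> \<alpha> \<tau> = {c \<in> (\<lambda>\<tau>. {\<tau>}) ` K02. \<exists>b\<in>?B. c = {\<tau>} + b}"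
    using True \<tau> by (simp add: H02_class_def H02_rel_def subquot_def Dbar_kernel_eq Hmu_class_0 Image_def)
  also have "\<dots> = (\<lambda>\<tau>. {\<tau>}) ` {\<tau>' \<in> K02. \<exists>b\<in>?B. {\<tau>'} = {\<tau>} + b}" by blast
  also have "{\<tau>' \<in> K02. \<exists>b\<in>?B. {\<tau>'} = {\<tau>} + b} =
      {\<tau>' \<in> K02. \<exists>\<beta>\<in>cocycles M W \<mu> 0 1. \<tau>' = \<tau> + br \<alpha> \<beta>}"
    using key by (intro Collect_cong conj_cong refl)
  finally show ?thesis by (simp only: True if_True)
next
  case False
  then show ?thesis
    by (auto simp: H02_class_def H02_rel_def subquot_def Dbar_kernel_eq Hmu_class_0)
qed

lemma H02_class_self: "\<tau> \<in> K02 \<Longrightarrow> {\<tau>} \<in> H02_class M W \<mu> \<alpha> \<tau>"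
  using cocycles_0[of 0 1] \<alpha>_facts(1)
  by (auto simp: H02_class_eq intro!: imageI bexI[of _ 0] simp: bracket_0_right)

lemma H02_eq: "H02 M W \<mu> \<alpha> = H02_class M W \<mu> \<alpha> ` K02"
proof -
  have "Hmu_class M W \<mu> 0 2 \<tau> = {\<tau>}" if "\<tau> \<in> K02" for \<tau>
    using that by (simp add: Hmu_class_0 K02_def cocycles_def)
  then show ?thesis
    unfolding H02_def quotient_def Dbar_kernel_eq H02_class_def by auto
qed

text \<open>Elements of \<open>H02\<close> are nonempty, whereas \<open>H02_class\<close> is empty
  off \<open>K02\<close>.\<close>

lemma H02_class_mem_iff: "H02_class M W \<mu> \<alpha> \<tau> \<in> H02 M W \<mu> \<alpha> \<longleftrightarrow> \<tau> \<in> K02"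
proof
  assume "H02_class M W \<mu> \<alpha> \<tau> \<in> H02 M W \<mu> \<alpha>"
  then have "H02_class M W \<mu> \<alpha> \<tau> \<noteq> {}" using H02_class_self by (auto simp: H02_eq)
  then show "\<tau> \<in> K02" by (metis H02_class_eq)
qed (simp add: H02_eq)

lemma H02_odd_eq: "H02_odd M W \<mu> \<alpha> = H02_class M W \<mu> \<alpha> ` {\<tau> \<in> K02. parity 1 \<tau>}"
  unfolding H02_odd_def using H02_class_mem_iff by (auto simp: K02_def)

lemma H02_class_eq_iff:
  assumes \<tau>: "\<tau> \<in> K02" "parity 1 \<tau>" and \<tau>': "\<tau>' \<in> K02" "parity 1 \<tau>'"
  shows "H02_class M W \<mu> \<alpha> \<tau> = H02_class M W \<mu> \<alpha> \<tau>' \<longleftrightarrow>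
    (\<exists>\<beta>\<in>B01. br \<mu> \<beta> = 0 \<and> \<tau>' = \<tau> + br \<alpha> \<beta>)"
proof
  assume "H02_class M W \<mu> \<alpha> \<tau> = H02_class M W \<mu> \<alpha> \<tau>'"
  then have "{\<tau>'} \<in> H02_class M W \<mu> \<alpha> \<tau>" using H02_class_self[OF \<tau>'(1)] by simp
  then obtain \<beta> where \<beta>: "\<beta> \<in> cocycles M W \<mu> 0 1" "\<tau>' = \<tau> + br \<alpha> \<beta>"
    using \<tau> by (auto simp: H02_class_eq)
  then have \<beta>c: "\<beta> \<in> cochains (M \<uplus> W)" and \<beta>CM: "\<beta> \<in> CM M W 0 1" and \<beta>0: "br \<mu> \<beta> = 0"
    by (auto simp: cocycles_def dest: CM_cochains)
  have "br \<alpha> \<beta> = \<tau>' - \<tau>" using \<beta>(2) by simp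
  moreover have "\<tau>' - \<tau> \<in> cochains (M \<uplus> W)" "parity 1 (\<tau>' - \<tau>)"
    using \<tau> \<tau>' by (auto simp: K02_def intro: cochains_diff CM_cochains has_parity_diff)
  \<comment> \<open>The value is odd, so it comes from the even part of \<beta>; that part is still
    a cocycle, since the bracket with \<mu> respects parity parts.\<close>
  ultimately have "br \<alpha> (parity_part (M \<uplus> W) 0 \<beta>) = br \<alpha> \<beta>"
    by (simp add: bracket_parity_part[OF \<alpha>_facts \<beta>c] parity_part_parity)
  moreover have "br \<mu> (parity_part (M \<uplus> W) 0 \<beta>) = 0"
    by (simp add: bracket_parity_part[OF \<mu>_cochain \<mu>_odd \<beta>c] \<beta>0)
  ultimately show "\<exists>\<beta>\<in>B01. br \<mu> \<beta> = 0 \<and> \<tau>' = \<tau> + br \<alpha> \<beta>"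
    using CM_parity_part[OF \<beta>CM] has_parity_parity_part[OF \<beta>c] \<beta>(2)
    by (intro bexI[of _ "parity_part (M \<uplus> W) 0 \<beta>"]) simp_all
next
  assume "\<exists>\<beta>\<in>B01. br \<mu> \<beta> = 0 \<and> \<tau>' = \<tau> + br \<alpha> \<beta>"
  then obtain \<beta> where \<beta>: "\<beta> \<in> cocycles M W \<mu> 0 1" "\<tau>' = \<tau> + br \<alpha> \<beta>"
    by (auto simp: cocycles_def)
  have c: "\<gamma> \<in> cochains (M \<uplus> W)" if "\<gamma> \<in> cocycles M W \<mu> 0 1" for \<gamma>
    using that by (auto simp: cocycles_def dest: CM_cochains)
  \<comment> \<open>Translation by the cocycle \<beta> identifies the two cosets.\<close>
  have "(\<exists>\<gamma>\<in>cocycles M W \<mu> 0 1. \<sigma> = \<tau> + br \<alpha> \<gamma>) \<longleftrightarrow> (\<exists>\<gamma>\<in>cocycles M W \<mu> 0 1. \<sigma> = \<tau>' + br \<alpha> \<gamma>)" for \<sigma>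
  proof
    assume "\<exists>\<gamma>\<in>cocycles M W \<mu> 0 1. \<sigma> = \<tau> + br \<alpha> \<gamma>"
    then obtain \<gamma> where \<gamma>: "\<gamma> \<in> cocycles M W \<mu> 0 1" "\<sigma> = \<tau> + br \<alpha> \<gamma>" by blast
    have "\<gamma> - \<beta> \<in> cocycles M W \<mu> 0 1"
      using \<beta>(1) \<gamma>(1) c by (simp add: cocycles_def CM_diff bracket_diff_right \<mu>_cochain)
    moreover have "\<sigma> = \<tau>' + br \<alpha> (\<gamma> - \<beta>)"
      using c[OF \<beta>(1)] c[OF \<gamma>(1)] by (simp add: \<beta>(2) \<gamma>(2) bracket_diff_right \<alpha>_facts(1))
    ultimately show "\<exists>\<gamma>\<in>cocycles M W \<mu> 0 1. \<sigma> = \<tau>' + br \<alpha> \<gamma>" by blast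
  next
    assume "\<exists>\<gamma>\<in>cocycles M W \<mu> 0 1. \<sigma> = \<tau>' + br \<alpha> \<gamma>"
    then obtain \<gamma> where \<gamma>: "\<gamma> \<in> cocycles M W \<mu> 0 1" "\<sigma> = \<tau>' + br \<alpha> \<gamma>" by blast
    have "\<beta> + \<gamma> \<in> cocycles M W \<mu> 0 1"
      using \<beta>(1) \<gamma>(1) c by (simp add: cocycles_def CM_plus bracket_plus_right \<mu>_cochain)
    moreover have "\<sigma> = \<tau> + br \<alpha> (\<beta> + \<gamma>)"
      using c[OF \<beta>(1)] c[OF \<gamma>(1)] by (simp add: \<beta>(2) \<gamma>(2) bracket_plus_right \<alpha>_facts(1) add.assoc)
    ultimately show "\<exists>\<gamma>\<in>cocycles M W \<mu> 0 1. \<sigma> = \<tau> + br \<alpha> \<gamma>" by blast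
  qed
  then show "H02_class M W \<mu> \<alpha> \<tau> = H02_class M W \<mu> \<alpha> \<tau>'"
    using \<tau> \<tau>' by (simp add: H02_class_eq)
qed

text \<open>The equations are affine in \<psi>; subtracting those of the given \<psi> leaves 2
  [\<mu>, \<tau>] = 0 and [\<alpha>, \<tau>] = 0.\<close>

lemma is_extension_add_iff:
  assumes "parity 1 \<tau>" "\<tau> \<in> CM M W 0 2"
  shows "is_extension M W \<delta> \<mu> lam (\<psi> + \<tau>) \<longleftrightarrow> \<tau> \<in> K02"
proof -
  have lam: "lam \<in> CM M W 1 1" "parity 1 lam" using ext by (auto simp: is_extension_def)
  note iff = is_extension_iff[OF lam]
  have \<psi>: "\<psi> \<in> CM M W 0 2" "parity 1 \<psi>" "br \<mu> lam = 0" "br \<alpha> \<psi> = 0"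
    and eq: "br \<alpha> \<alpha> + (br \<mu> \<psi> + br \<mu> \<psi>) = 0" using ext iff by auto
  note c = CM_cochains[OF \<psi>(1)] CM_cochains[OF assms(2)]
  have "br \<alpha> \<alpha> + (br \<mu> (\<psi> + \<tau>) + br \<mu> (\<psi> + \<tau>)) = (br \<alpha> \<alpha> + (br \<mu> \<psi> + br \<mu> \<psi>)) + (br \<mu> \<tau> + br \<mu> \<tau>)"
    by (simp add: bracket_plus_right \<mu>_cochain c algebra_simps)
  then have "br \<alpha> \<alpha> + (br \<mu> (\<psi> + \<tau>) + br \<mu> (\<psi> + \<tau>)) = br \<mu> \<tau> + br \<mu> \<tau>" by (simp add: eq)
  moreover have "br \<mu> \<tau> + br \<mu> \<tau> = 0 \<longleftrightarrow> br \<mu> \<tau> = 0" by (auto dest: double_fun_eq_zero)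
  ultimately show ?thesis
    by (simp add: iff K02_def CM_plus has_parity_plus assms \<psi> bracket_plus_right \<alpha>_facts(1) c)
qed

text \<open>An equivalence between extensions with the same \<lambda> comes from a cocycle \<beta>,
  and therefore acts on \<psi> by the translation [\<alpha>, \<beta>].\<close>

lemma rest_class_eq_iff_H02_class_eq:
  assumes \<tau>: "\<tau> \<in> K02" "parity 1 \<tau>" and \<tau>': "\<tau>' \<in> K02" "parity 1 \<tau>'"
  shows "H02_class M W \<mu> \<alpha> \<tau> = H02_class M W \<mu> \<alpha> \<tau>' \<longleftrightarrow>
    rest_class M W (\<delta> + \<mu> + lam + (\<psi> + \<tau>)) = rest_class M W (\<delta> + \<mu> + lam + (\<psi> + \<tau>'))"
proof -
  have e: "is_extension M W \<delta> \<mu> lam (\<psi> + \<tau>)" "is_extension M W \<delta> \<mu> lam (\<psi> + \<tau>')"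
    using assms is_extension_add_iff by (auto simp: K02_def)
  have "rest_class M W (\<delta> + \<mu> + lam + (\<psi> + \<tau>)) = rest_class M W (\<delta> + \<mu> + lam + (\<psi> + \<tau>')) \<longleftrightarrow>
      (\<exists>\<beta>\<in>B01. br \<mu> \<beta> = 0 \<and> \<tau>' = \<tau> + (br \<alpha> \<beta> + half_square \<beta>))"
    unfolding rest_class_extension_eq_iff[OF e] by (simp add: add.assoc)
  also have "\<dots> \<longleftrightarrow> (\<exists>\<beta>\<in>B01. br \<mu> \<beta> = 0 \<and> \<tau>' = \<tau> + br \<alpha> \<beta>)"
    by (intro bex_cong refl conj_cong) (simp add: half_square(4))
  finally show ?thesis by (simp add: H02_class_eq_iff[OF assms])
qed

lemma rest_classes_eq:
  "(\<lambda>\<tau>. rest_class M W (\<delta> + \<mu> + lam + (\<psi> + \<tau>))) ` {\<tau> \<in> K02. parity 1 \<tau>} =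
    {rest_class M W (\<delta> + \<mu> + lam' + \<psi>') | lam' \<psi>'. is_extension M W \<delta> \<mu> lam' \<psi>' \<and>
       Hmu_class M W \<mu> 1 1 lam' = Hmu_class M W \<mu> 1 1 lam}" (is "?L = ?R")
proof
  show "?L \<subseteq> ?R"
  proof
    fix d assume "d \<in> ?L"
    then obtain \<tau> where d: "d = rest_class M W (\<delta> + \<mu> + lam + (\<psi> + \<tau>))" and "\<tau> \<in> K02" "parity 1 \<tau>"
      by blast
    then have "is_extension M W \<delta> \<mu> lam (\<psi> + \<tau>)" by (simp add: is_extension_add_iff K02_def)
    then show "d \<in> ?R" unfolding d by blast
  qed
  show "?R \<subseteq> ?L"
  proof
    fix d assume "d \<in> ?R"
    then obtain lam' \<psi>' where d: "d = rest_class M W (\<delta> + \<mu> + lam' + \<psi>')"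
      and ext': "is_extension M W \<delta> \<mu> lam' \<psi>'"
      and "Hmu_class M W \<mu> 1 1 lam' = Hmu_class M W \<mu> 1 1 lam" by blast
    then obtain \<beta> where \<beta>: "\<beta> \<in> B01" and lam: "lam = lam' + br \<mu> \<beta>"
      using Hmu_class_11_eq_iff[OF extension_cocycle[OF ext'] extension_cocycle[OF ext]] by blast
    \<comment> \<open>Within its orbit the extension is moved from \<open>lam'\<close> to the fixed
      representative \<open>lam\<close>; the required \<tau> is then the difference of \<psi>'' and
      \<psi>.\<close>
    define \<psi>'' where "\<psi>'' = \<psi>' + (br (\<delta> + lam') \<beta> + half_square \<beta>)"
    have ext'': "is_extension M W \<delta> \<mu> lam \<psi>''"
      using is_extension_pullback[OF ext'] \<beta> by (simp add: lam \<psi>''_def)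
    have d: "d = rest_class M W (\<delta> + \<mu> + lam + \<psi>'')"
      unfolding d rest_class_extension_eq_iff[OF ext' ext''] using \<beta> lam \<psi>''_def by blast
    have "\<psi>'' - \<psi> \<in> CM M W 0 2" "parity 1 (\<psi>'' - \<psi>)"
      using ext ext'' by (auto simp: is_extension_def CM_diff has_parity_diff)
    moreover from this have "\<psi>'' - \<psi> \<in> K02"
      using is_extension_add_iff[of "\<psi>'' - \<psi>"] ext'' by simp
    ultimately show "d \<in> ?L" unfolding d by (intro image_eqI[of _ _ "\<psi>'' - \<psi>"]) simp_all
  qed
qed

lemma bij_H02_odd_rest_classes:
  "\<exists>F. bij_betw F (H02_odd M W \<mu> \<alpha>)
      {rest_class M W (\<delta> + \<mu> + lam' + \<psi>') | lam' \<psi>'. is_extension M W \<delta> \<mu> lam' \<psi>' \<and>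
         Hmu_class M W \<mu> 1 1 lam' = Hmu_class M W \<mu> 1 1 lam} \<and>
    (\<forall>\<tau>\<in>CM M W 0 2. parity 1 \<tau> \<and> H02_class M W \<mu> \<alpha> \<tau> \<in> H02_odd M W \<mu> \<alpha> \<longrightarrow>
       is_extension M W \<delta> \<mu> lam (\<psi> + \<tau>) \<and>
       F (H02_class M W \<mu> \<alpha> \<tau>) = rest_class M W (\<delta> + \<mu> + lam + \<psi> + \<tau>))"
proof -
  obtain F where F: "bij_betw F (H02_odd M W \<mu> \<alpha>)
      {rest_class M W (\<delta> + \<mu> + lam' + \<psi>') | lam' \<psi>'. is_extension M W \<delta> \<mu> lam' \<psi>' \<and>
         Hmu_class M W \<mu> 1 1 lam' = Hmu_class M W \<mu> 1 1 lam}"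
    and F_class: "\<And>\<tau>. \<tau> \<in> {\<tau> \<in> K02. parity 1 \<tau>} \<Longrightarrow>
      F (H02_class M W \<mu> \<alpha> \<tau>) = rest_class M W (\<delta> + \<mu> + lam + (\<psi> + \<tau>))"
    using bij_betw_factor[OF H02_odd_eq[symmetric] rest_classes_eq] rest_class_eq_iff_H02_class_eq
    by (smt (verit) mem_Collect_eq)
  have "\<tau> \<in> K02" if "H02_class M W \<mu> \<alpha> \<tau> \<in> H02_odd M W \<mu> \<alpha>" for \<tau>
    using that H02_class_mem_iff by (simp add: H02_odd_def)
  with F F_class show ?thesis by (auto simp: is_extension_add_iff add.assoc)
qed

end

end

theorem theorem6p1:
  fixes M :: "('k::field, 'm::ab_group_add) graded_space"
    and W :: "('k, 'w::ab_group_add) graded_space"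
    and \<delta> \<mu> :: "('m \<times> 'w) list \<Rightarrow> 'm \<times> 'w"
  assumes "CHAR('k) \<noteq> 2" and "CHAR('k) \<noteq> 3"
    and "graded_vector_space M" and "graded_vector_space W"
    and "algebra_structure_W M W \<delta>" and "algebra_structure_M M W \<mu>"
  shows
    "(\<forall>lam \<psi> lam' \<psi>'.
        is_extension M W \<delta> \<mu> lam \<psi> \<and> is_extension M W \<delta> \<mu> lam' \<psi>' \<and>
        rest_class M W (\<delta> + \<mu> + lam + \<psi>) = rest_class M W (\<delta> + \<mu> + lam' + \<psi>') \<longrightarrow>
        Hmu_class M W \<mu> 1 1 lam = Hmu_class M W \<mu> 1 1 lam')
     \<and> (\<forall>lam \<psi>. is_extension M W \<delta> \<mu> lam \<psi> \<longrightarrow> Hmu_class M W \<mu> 1 1 lam \<in> Hmu M W \<mu> 1 1)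
     \<and> (\<forall>lam \<in> cocycles M W \<mu> 1 1. has_parity (M \<uplus> W) 1 lam \<longrightarrow>
          ((\<exists>lam' \<psi>. is_extension M W \<delta> \<mu> lam' \<psi> \<and>
                     Hmu_class M W \<mu> 1 1 lam' = Hmu_class M W \<mu> 1 1 lam)
           \<longleftrightarrow> MC_condition M W \<delta> \<mu> lam))
     \<and> (\<forall>lam \<in> cocycles M W \<mu> 1 1. \<forall>lam' \<in> cocycles M W \<mu> 1 1.
          has_parity (M \<uplus> W) 1 lam \<and> has_parity (M \<uplus> W) 1 lam' \<and>
          Hmu_class M W \<mu> 1 1 lam = Hmu_class M W \<mu> 1 1 lam' \<longrightarrow>
          (MC_condition M W \<delta> \<mu> lam \<longleftrightarrow> MC_condition M W \<delta> \<mu> lam'))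
     \<and> (\<forall>lam \<psi>. is_extension M W \<delta> \<mu> lam \<psi> \<longrightarrow>
          (\<exists>F. bij_betw F (H02_odd M W \<mu> (\<delta> + lam))
                 {rest_class M W (\<delta> + \<mu> + lam' + \<psi>') | lam' \<psi>'.
                    is_extension M W \<delta> \<mu> lam' \<psi>' \<and>
                    Hmu_class M W \<mu> 1 1 lam' = Hmu_class M W \<mu> 1 1 lam}
               \<and> (\<forall>\<tau> \<in> CM M W 0 2.
                    has_parity (M \<uplus> W) 1 \<tau> \<and>
                    H02_class M W \<mu> (\<delta> + lam) \<tau> \<in> H02_odd M W \<mu> (\<delta> + lam) \<longrightarrow>
                    is_extension M W \<delta> \<mu> lam (\<psi> + \<tau>) \<and>
                    F (H02_class M W \<mu> (\<delta> + lam) \<tau>) = rest_class M W (\<delta> + \<mu> + lam + \<psi> + \<tau>))))"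
proof -
  have "(2::'k) \<noteq> 0"
  proof
    assume "(2::'k) = 0"
    then have "CHAR('k) dvd 2" using of_nat_eq_0_iff_char_dvd[where ?'a = 'k and n = 2] by simp
    then have "CHAR('k) \<le> 2" "0 < CHAR('k)" by (auto intro: dvd_imp_le gr0I)
    then have "CHAR('k) = 1" using \<open>CHAR('k) \<noteq> 2\<close> by linarith
    then show False using CHAR_not_1' by simp
  qed
  then interpret extension_data M W \<delta> \<mu>
    using assms by unfold_locales simp_all
  show ?thesis
  proof (intro conjI allI ballI impI)
    fix lam \<psi> lam' \<psi>'
    assume "is_extension M W \<delta> \<mu> lam \<psi> \<and> is_extension M W \<delta> \<mu> lam' \<psi>' \<and>
        rest_class M W (\<delta> + \<mu> + lam + \<psi>) = rest_class M W (\<delta> + \<mu> + lam' + \<psi>')"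
    then have e: "is_extension M W \<delta> \<mu> lam \<psi>" "is_extension M W \<delta> \<mu> lam' \<psi>'"
      and "rest_class M W (\<delta> + \<mu> + lam + \<psi>) = rest_class M W (\<delta> + \<mu> + lam' + \<psi>')" by blast+
    then show "Hmu_class M W \<mu> 1 1 lam = Hmu_class M W \<mu> 1 1 lam'"
      using Hmu_class_11_eq_iff[OF extension_cocycle[OF e(1)] extension_cocycle[OF e(2)]]
        rest_class_extension_eq_iff[OF e] by blast
  next
    fix lam \<psi> assume "is_extension M W \<delta> \<mu> lam \<psi>"
    then show "Hmu_class M W \<mu> 1 1 lam \<in> Hmu M W \<mu> 1 1"
      unfolding Hmu_class_def Hmu_def by (intro quotientI extension_cocycle(1))
  next
    fix lam assume "lam \<in> cocycles M W \<mu> 1 1" "parity 1 lam"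
    then show "(\<exists>lam' \<psi>. is_extension M W \<delta> \<mu> lam' \<psi> \<and>
        Hmu_class M W \<mu> 1 1 lam' = Hmu_class M W \<mu> 1 1 lam) \<longleftrightarrow> MC_condition M W \<delta> \<mu> lam"
      by (rule extension_class_iff_MC)
  next
    fix lam lam' assume "lam \<in> cocycles M W \<mu> 1 1" "lam' \<in> cocycles M W \<mu> 1 1"
      "parity 1 lam \<and> parity 1 lam' \<and> Hmu_class M W \<mu> 1 1 lam = Hmu_class M W \<mu> 1 1 lam'"
    \<comment> \<open>By \<open>extension_class_iff_MC\<close> both sides become the same statement
      about the common class.\<close>
    then show "MC_condition M W \<delta> \<mu> lam \<longleftrightarrow> MC_condition M W \<delta> \<mu> lam'"
      by (simp flip: extension_class_iff_MC)
  next
    fix lam \<psi> assume "is_extension M W \<delta> \<mu> lam \<psi>"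
    then show "\<exists>F. bij_betw F (H02_odd M W \<mu> (\<delta> + lam))
                 {rest_class M W (\<delta> + \<mu> + lam' + \<psi>') | lam' \<psi>'.
                    is_extension M W \<delta> \<mu> lam' \<psi>' \<and>
                    Hmu_class M W \<mu> 1 1 lam' = Hmu_class M W \<mu> 1 1 lam}
               \<and> (\<forall>\<tau> \<in> CM M W 0 2.
                    has_parity (M \<uplus> W) 1 \<tau> \<and>
                    H02_class M W \<mu> (\<delta> + lam) \<tau> \<in> H02_odd M W \<mu> (\<delta> + lam) \<longrightarrow>
                    is_extension M W \<delta> \<mu> lam (\<psi> + \<tau>) \<and>
                    F (H02_class M W \<mu> (\<delta> + lam) \<tau>) = rest_class M W (\<delta> + \<mu> + lam + \<psi> + \<tau>))"
      by (rule bij_H02_odd_rest_classes)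
  qed
qed

end
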